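(* Let $a_1>a_2>0$, let $E=\{(x_1,x_2)\in\mathbb{R}^2:(x_1/a_1)^2+(x_2/a_2)^2\le1\}$, and let $\varepsilon=\sqrt{1-a_2^2/a_1^2}$ be its eccentricity. For every $\nu_0\in(0,\pi/2)$ it holds for all sufficiently large $m$ that $$\rho_{\nu_0}(m,0)\ \le\ \sqrt2\,\pi\,\mathrm{e}\,\exp\left(-\frac14\,\varepsilon\,k_m\,a_1\,\phi_0\sin\phi_0\right),$$ where $\phi_0=\pi/2-\nu_0$.
   Context: Let $a=\sqrt{a_1^2-a_2^2}=a_1\varepsilon$, $\mu_0:=\tanh^{-1}(a_2/a_1)$, and use elliptical coordinates $x_1=a\cosh\mu\cos\nu$, $x_2=a\sinh\mu\sin\nu$, in which $E$ is given by $0\le\mu\le\mu_0$, $0\le\nu<2\pi$. For $q>0$, $a_0(q)$ denotes the smallest $\alpha$ for which the Mathieu equation $N''(\nu)+(\alpha-2q\cos2\nu)N(\nu)=0$ has a non-trivial even $2\pi$-periodic solution, and $\mathrm{ce}_0(\cdot,q)$ is the corresponding real-valued even periodic solution (unique up to a constant multiple; with its standard normalisation). $\mathrm{Mc}_0^{(1)}(\cdot,q)$ denotes the real-valued non-trivial even solution $M\in C^2(\mathbb{R})$ (unique up to a constant multiple; with its standard normalisation) of $M''(\mu)-(a_0(q)-2q\cosh2\mu)M(\mu)=0$. For each $m\in\{0,1,2,\ldots\}$ it is known that there is a unique $q_m>0$ such that $\mathrm{Mc}_0^{(1)}(\mu_0,q_m)=0$ and $\mathrm{Mc}_0^{(1)}(\cdot,q_m)$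 has exactly $m$ zeros in $(0,\mu_0)$. Put $k_m:=\sqrt{4q_m}/a$ and $$u_{m,0}(x):=\mathrm{Mc}_0^{(1)}(\mu,q_m)\,\mathrm{ce}_0(\nu,q_m),$$ which satisfies $\Delta u_{m,0}+k_m^2u_{m,0}=0$ in $E$ and $u_{m,0}=0$ on $\partial E$; moreover $k_m\to\infty$ as $m\to\infty$. For $\nu_0\in(0,\pi/2)$ let $$E_{\nu_0}:=\{(a\cosh\mu\cos\nu,a\sinh\mu\sin\nu):0\le\mu<\mu_0,\ |\nu|<\nu_0\text{ or }|\pi-\nu|<\nu_0\}$$ and $$\rho_{\nu_0}(m,0):=\left\{\frac{\int_{E_{\nu_0}}(u_{m,0})^2\,dx}{\int_E(u_{m,0})^2\,dx}\right\}^{1/2}.$$ *)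

theory Defs
  imports "HOL-Analysis.Analysis"
begin

definition ellipse :: "real \<Rightarrow> real \<Rightarrow> (real^2) set" where
  "ellipse a1 a2 = {x. (x$1 / a1)\<^sup>2 + (x$2 / a2)\<^sup>2 \<le> 1}"

definition eccentricity :: "real \<Rightarrow> real \<Rightarrow> real" where
  "eccentricity a1 a2 = sqrt (1 - a2\<^sup>2 / a1\<^sup>2)"

definition focal_distance :: "real \<Rightarrow> real \<Rightarrow> real" where
  "focal_distance a1 a2 = sqrt (a1\<^sup>2 - a2\<^sup>2)"

definition mu_boundary :: "real \<Rightarrow> real \<Rightarrow> real" where
  "mu_boundary a1 a2 = artanh (a2 / a1)"

definition elliptic_point :: "real \<Rightarrow> real \<Rightarrow> real \<Rightarrow> real^2" where
  "elliptic_point a \<mu> \<nu> = vector [a * cosh \<mu> * cos \<nu>, a * sinh \<mu> * sin \<nu>]"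

definition mathieu_solution :: "real \<Rightarrow> real \<Rightarrow> (real \<Rightarrow> real) \<Rightarrow> bool" where
  "mathieu_solution \<alpha> q N \<longleftrightarrow>
     (\<exists>N' N''. \<forall>\<nu>. (N has_real_derivative N' \<nu>) (at \<nu>) \<and>
                (N' has_real_derivative N'' \<nu>) (at \<nu>) \<and>
                N'' \<nu> + (\<alpha> - 2 * q * cos (2 * \<nu>)) * N \<nu> = 0)"

definition modified_mathieu_solution :: "real \<Rightarrow> real \<Rightarrow> (real \<Rightarrow> real) \<Rightarrow> bool" where
  "modified_mathieu_solution \<alpha> q M \<longleftrightarrow>
     (\<exists>M' M''. \<forall>\<mu>. (M has_real_derivative M' \<mu>) (at \<mu>) \<and>
                (M' has_real_derivative M'' \<mu>) (at \<mu>) \<and>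
                M'' \<mu> - (\<alpha> - 2 * q * cosh (2 * \<mu>)) * M \<mu> = 0)"

definition even_periodic_mathieu_solution :: "real \<Rightarrow> real \<Rightarrow> (real \<Rightarrow> real) \<Rightarrow> bool" where
  "even_periodic_mathieu_solution \<alpha> q N \<longleftrightarrow>
     mathieu_solution \<alpha> q N \<and> (\<exists>\<nu>. N \<nu> \<noteq> 0) \<and>
     (\<forall>\<nu>. N (- \<nu>) = N \<nu>) \<and> (\<forall>\<nu>. N (\<nu> + 2 * pi) = N \<nu>)"

definition is_mathieu_a0 :: "real \<Rightarrow> real \<Rightarrow> bool" where
  "is_mathieu_a0 q \<alpha> \<longleftrightarrow>
     (\<exists>N. even_periodic_mathieu_solution \<alpha> q N) \<and>
     (\<forall>\<beta>. (\<exists>N. even_periodic_mathieu_solution \<beta> q N) \<longrightarrow> \<alpha> \<le> \<beta>)"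

(* ce_0 and Mc_0^(1) are unique up to a nonzero constant factor; the two predicates below
   leave this factor free, so the standard normalisation is included as one choice. *)

definition is_ce0 :: "real \<Rightarrow> (real \<Rightarrow> real) \<Rightarrow> bool" where
  "is_ce0 q N \<longleftrightarrow> (\<exists>\<alpha>. is_mathieu_a0 q \<alpha> \<and> even_periodic_mathieu_solution \<alpha> q N)"

definition is_Mc0 :: "real \<Rightarrow> (real \<Rightarrow> real) \<Rightarrow> bool" where
  "is_Mc0 q M \<longleftrightarrow>
     (\<exists>\<alpha>. is_mathieu_a0 q \<alpha> \<and> modified_mathieu_solution \<alpha> q M) \<and>
     (\<exists>\<mu>. M \<mu> \<noteq> 0) \<and> (\<forall>\<mu>. M (- \<mu>) = M \<mu>)"

(* The coordinates of x are unique except on the focal segment, where \<nu> and -\<nu> (mod 2 pi)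
   give the same point; for even 2 pi-periodic N the value M \<mu> * N \<nu> is unique everywhere. *)
definition elliptic_product :: "real \<Rightarrow> (real \<Rightarrow> real) \<Rightarrow> (real \<Rightarrow> real) \<Rightarrow> real^2 \<Rightarrow> real" where
  "elliptic_product a M N x =
     (THE v. \<exists>\<mu> \<nu>. 0 \<le> \<mu> \<and> 0 \<le> \<nu> \<and> \<nu> < 2 * pi \<and>
                   x = elliptic_point a \<mu> \<nu> \<and> v = M \<mu> * N \<nu>)"

definition ellipse_sector :: "real \<Rightarrow> real \<Rightarrow> real \<Rightarrow> (real^2) set" where
  "ellipse_sector a1 a2 \<nu>0 =
     {elliptic_point (focal_distance a1 a2) \<mu> \<nu> | \<mu> \<nu>.
        0 \<le> \<mu> \<and> \<mu> < mu_boundary a1 a2 \<and> (\<bar>\<nu>\<bar> < \<nu>0 \<or> \<bar>pi - \<nu>\<bar> < \<nu>0)}"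

definition L2_ratio :: "real \<Rightarrow> real \<Rightarrow> real \<Rightarrow> (real^2 \<Rightarrow> real) \<Rightarrow> real" where
  "L2_ratio a1 a2 \<nu>0 u =
     sqrt ((LINT x:ellipse_sector a1 a2 \<nu>0|lebesgue. (u x)\<^sup>2) /
           (LINT x:ellipse a1 a2|lebesgue. (u x)\<^sup>2))"

end

theory Submission
  imports Defs
begin

text \<open>For large \<open>q\<close> the eigenvalue satisfies \<open>a\<^sub>0(q) \<le> - 2 q + 8 \<surd>q\<close>, so near the angles \<open>0\<close> and \<open>\<pi>\<close> the
  Mathieu equation reads \<open>N'' = g N\<close> with \<open>g \<ge> 4 q cos\<^sup>2 \<nu> - 8 \<surd>q\<close>, and \<open>N\<close> grows exponentially towards
  \<open>\<plusminus>\<pi>/2\<close>. Hence \<open>N\<^sup>2\<close> on the sector is exponentially small compared with its values at slightly larger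
  distance from \<open>0\<close> or \<open>\<pi>\<close>. The area element \<open>a\<^sup>2 (sinh\<^sup>2 \<mu> + sin\<^sup>2 \<nu>) d\<mu> d\<nu>\<close> increases in the same direction, so
  the factor \<open>M(\<mu>)\<close> plays no role in the comparison. It only enters through \<open>q\<^sub>m \<rightarrow> \<infinity>\<close>, which holds
  because for bounded \<open>q\<close> the zeros of \<open>M\<close> are uniformly separated. The bound on \<open>a\<^sub>0(q)\<close> needs an even
  periodic solution with a small parameter, which is found by shooting.\<close>

subsection \<open>Second-order linear differential equations\<close>

text \<open>Since eps k_m a_1 = 2 sqrt(q_m), the claim asks the squared ratio to decay with exponent
  sqrt(q_m) phi sin phi. Growth of N^2 from nu_0 to the angle halfway to pi/2, at the rate 2
  sqrt(q_m) sin(phi/2) valid there, yields about 2 sqrt(q_m) phi sin(phi/2), which is larger by the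
  factor 1/cos(phi/2). Half of this surplus is spent on measuring the comparison mass in a thin
  strip instead of at one angle; the other half outgrows all constants. So for the error in a_0(q)
  only the order sqrt(q), small against q, matters. As a_0(q) is a minimum over the parameters that
  admit an even periodic solution, one such solution bounds it from above. The search is restricted
  to solutions symmetric about both 0 and pi/2, which leaves one equation in the one unknown
  parameter.\<close>

text \<open>Gronwall's argument: with |p| at most K between c and x, the energy y^2 + y'^2 changes
  at relative rate at most 1 + K, so it cannot leave 0 in either direction.\<close>

lemma second_order_linear_ode_unique_zero:
  fixes y y' p :: "real \<Rightarrow> real"
  assumes y: "\<And>t. (y has_real_derivative y' t) (at t)"
    and y': "\<And>t. (y' has_real_derivative p t * y t) (at t)"
    and p: "continuous_on UNIV p" and "y c = 0" "y' c = 0"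
  shows "y x = 0"
proof -
  have "bounded (p ` closed_segment c x)"
    by (intro compact_imp_bounded compact_continuous_image continuous_on_subset[OF p]) auto
  then obtain K where K: "\<And>t. t \<in> closed_segment c x \<Longrightarrow> \<bar>p t\<bar> \<le> K"
    unfolding bounded_iff by auto
  define E where "E t = (y t)\<^sup>2 + (y' t)\<^sup>2" for t
  have E': "(E has_real_derivative 2 * (1 + p t) * (y t * y' t)) (at t)" for t
    unfolding E_def by (auto intro!: derivative_eq_intros y y' simp: algebra_simps power2_eq_square)
  have bound: "\<bar>2 * (1 + p t) * (y t * y' t)\<bar> \<le> (1 + K) * E t" if "t \<in> closed_segment c x" for t
  proof -
    have "2 * \<bar>y t * y' t\<bar> \<le> E t"
      unfolding E_def abs_mult using sum_squares_bound[of "\<bar>y t\<bar>" "\<bar>y' t\<bar>"] by simp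
    then have "\<bar>1 + p t\<bar> * (2 * \<bar>y t * y' t\<bar>) \<le> (1 + K) * E t"
      using K[OF that] by (intro mult_mono) (auto simp: E_def)
    then show ?thesis by (simp only: abs_mult abs_numeral mult_ac)
  qed
  have "E x \<le> 0"
  proof (cases "c \<le> x")
    case True
    have "E x * exp (-(1 + K) * x) \<le> E c * exp (-(1 + K) * c)"
    proof (rule DERIV_nonpos_imp_nonincreasing[OF True])
      fix t assume t: "c \<le> t" "t \<le> x"
      then have "t \<in> closed_segment c x" using True by (simp add: closed_segment_eq_real_ivl)
      then have "(2 * (1 + p t) * (y t * y' t) - (1 + K) * E t) * exp (-(1 + K) * t) \<le> 0"
        using bound[of t] by (intro mult_nonpos_nonneg) auto
      moreover have "((\<lambda>t. E t * exp (-(1 + K) * t)) has_real_derivative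
        (2 * (1 + p t) * (y t * y' t) - (1 + K) * E t) * exp (-(1 + K) * t)) (at t)"
        by (auto intro!: derivative_eq_intros E' simp: algebra_simps)
      ultimately show "\<exists>d. ((\<lambda>t. E t * exp (-(1 + K) * t)) has_real_derivative d) (at t) \<and> d \<le> 0"
        by blast
    qed
    then show ?thesis using assms by (simp add: E_def mult_le_0_iff)
  next
    case False
    then have le: "x \<le> c" by simp
    have "E x * exp ((1 + K) * x) \<le> E c * exp ((1 + K) * c)"
    proof (rule DERIV_nonneg_imp_nondecreasing[OF le])
      fix t assume t: "x \<le> t" "t \<le> c"
      then have "t \<in> closed_segment c x" using le by (simp add: closed_segment_eq_real_ivl)
      then have "0 \<le> (2 * (1 + p t) * (y t * y' t) + (1 + K) * E t) * exp ((1 + K) * t)"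
        using bound[of t] by (intro mult_nonneg_nonneg) auto
      moreover have "((\<lambda>t. E t * exp ((1 + K) * t)) has_real_derivative
        (2 * (1 + p t) * (y t * y' t) + (1 + K) * E t) * exp ((1 + K) * t)) (at t)"
        by (auto intro!: derivative_eq_intros E' simp: algebra_simps)
      ultimately show "\<exists>d. ((\<lambda>t. E t * exp ((1 + K) * t)) has_real_derivative d) (at t) \<and> 0 \<le> d"
        by blast
    qed
    then show ?thesis using assms by (simp add: E_def mult_le_0_iff)
  qed
  then show ?thesis by (simp add: E_def sum_power2_le_zero_iff)
qed

text \<open>The substitution \<open>t = x s\<close> turns the integral of \<open>(x - t) p(t, b) y(t)\<close> over \<open>0 \<le> t \<le> x\<close>, the Picard
  operator of \<open>y'' = p y\<close>, into an integral over a fixed interval; this makes the terms jointly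
  continuous in \<open>(x, b)\<close>.\<close>

primrec picard_term :: "(real \<times> real \<Rightarrow> real) \<Rightarrow> nat \<Rightarrow> real \<times> real \<Rightarrow> real" where
  "picard_term p 0 = (\<lambda>_. 1)"
| "picard_term p (Suc n) = (\<lambda>xb. integral (cbox 0 1) (\<lambda>s. (fst xb)\<^sup>2 * (1 - s) * p (fst xb * s, snd xb) * picard_term p n (fst xb * s, snd xb)))"

lemma continuous_picard_term:
  assumes p: "continuous_on UNIV p"
  shows "continuous_on UNIV (picard_term p n)"
proof (induction n)
  case 0
  show ?case by simp
next
  case (Suc n)
  note [continuous_intros] = continuous_on_compose2[OF p] continuous_on_compose2[OF Suc]
  show ?case unfolding picard_term.simps
    by (intro integral_continuous_on_param) (auto intro!: continuous_intros simp: case_prod_unfold)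
qed

text \<open>Bounding 1 - s by 1 leaves the integral of s^(2n), which is 1/(2n+1); weakening this to
  1/(n+1) lets the factorial build up by induction.\<close>

lemma picard_term_bound:
  assumes p: "continuous_on UNIV p"
    and K: "\<And>x b. \<bar>x\<bar> \<le> X \<Longrightarrow> \<bar>b\<bar> \<le> B \<Longrightarrow> \<bar>p (x, b)\<bar> \<le> K"
    and "\<bar>x\<bar> \<le> X" "\<bar>b\<bar> \<le> B"
  shows "\<bar>picard_term p n (x, b)\<bar> \<le> (K * x\<^sup>2) ^ n / fact n"
  using \<open>\<bar>x\<bar> \<le> X\<close>
proof (induction n arbitrary: x)
  case 0
  show ?case by simp
next
  case (Suc n)
  note [continuous_intros] = continuous_on_compose2[OF p] continuous_on_compose2[OF continuous_picard_term[OF p]]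
  have K0: "0 \<le> K" using K[OF Suc.prems \<open>\<bar>b\<bar> \<le> B\<close>] by linarith
  let ?c = "K ^ Suc n * x ^ (2 * Suc n) / fact n"
  have pow: "((\<lambda>s. s ^ Suc m / real (Suc m)) has_real_derivative s ^ m) (at s within T)" for s m T
    using DERIV_cdivide[OF DERIV_pow[of "Suc m" s T], of "real (Suc m)"]
    by (simp only: diff_Suc_Suc minus_nat.diff_0 nonzero_mult_div_cancel_left of_nat_neq_0 not_False_eq_True)
  have "((\<lambda>s. ?c * (s ^ Suc (2*n) / real (Suc (2*n)))) has_real_derivative ?c * s ^ (2 * n)) (at s within T)" for s T
    by (rule DERIV_cmult[OF pow])
  then have int: "((\<lambda>s. ?c * s ^ (2 * n)) has_integral ?c / real (Suc (2 * n))) (cbox 0 1)"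
    using fundamental_theorem_of_calculus[of 0 1 "\<lambda>s. ?c * (s ^ Suc (2*n) / real (Suc (2*n)))" "\<lambda>s. ?c * s ^ (2 * n)"]
    by (simp add: has_real_derivative_iff_has_vector_derivative)
  have "norm (integral (cbox 0 1) (\<lambda>s. x\<^sup>2 * (1 - s) * p (x * s, b) * picard_term p n (x * s, b)))
      \<le> integral (cbox 0 1) (\<lambda>s. ?c * s ^ (2 * n))"
  proof (rule integral_norm_bound_integral)
    show "(\<lambda>s. x\<^sup>2 * (1 - s) * p (x * s, b) * picard_term p n (x * s, b)) integrable_on cbox 0 1"
      by (intro integrable_continuous) (auto intro!: continuous_intros)
    show "(\<lambda>s. ?c * s ^ (2 * n)) integrable_on cbox 0 1" using int by blast
    fix s :: real assume "s \<in> cbox 0 1"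
    then have s: "0 \<le> s" "s \<le> 1" by auto
    have xs: "\<bar>x * s\<bar> \<le> X" using s Suc.prems mult_left_le[of "\<bar>s\<bar>" "\<bar>x\<bar>"] by (simp add: abs_mult)
    have "norm (x\<^sup>2 * (1 - s) * p (x * s, b) * picard_term p n (x * s, b))
        = x\<^sup>2 * (1 - s) * \<bar>p (x * s, b)\<bar> * \<bar>picard_term p n (x * s, b)\<bar>"
      using s by (simp add: abs_mult)
    also have "\<dots> \<le> x\<^sup>2 * 1 * K * ((K * (x * s)\<^sup>2) ^ n / fact n)"
      using s K[OF xs \<open>\<bar>b\<bar> \<le> B\<close>] Suc.IH[OF xs] K0 by (intro mult_mono) auto
    also have "\<dots> = ?c * s ^ (2 * n)"
      by (simp add: power_mult_distrib power_mult power2_eq_square mult_ac)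
    finally show "norm (x\<^sup>2 * (1 - s) * p (x * s, b) * picard_term p n (x * s, b)) \<le> ?c * s ^ (2 * n)" .
  qed
  also have "\<dots> = ?c / real (Suc (2 * n))" using int by (rule integral_unique)
  also have "\<dots> \<le> ?c / real (Suc n)"
  proof (intro divide_left_mono)
    show "0 \<le> ?c"
      by (intro divide_nonneg_nonneg mult_nonneg_nonneg zero_le_power[OF K0] zero_le_even_power) auto
  qed auto
  also have "\<dots> = (K * x\<^sup>2) ^ Suc n / fact (Suc n)"
    by (simp add: power_mult_distrib power_mult power2_eq_square mult_ac)
  finally show ?case by simp
qed


text \<open>Shooting varies the parameter b, so continuity of z and z' in both variables together is
  the point. The Picard series converges uniformly on squares, which gives continuity;
  differentiability in x follows only after the fixed-point equation is rewritten as a double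
  integral.\<close>

theorem second_order_linear_ode_parametric_solution:
  fixes p :: "real \<times> real \<Rightarrow> real"
  assumes p: "continuous_on UNIV p"
  obtains z z' :: "real \<times> real \<Rightarrow> real"
  where "continuous_on UNIV z" "continuous_on UNIV z'"
    and "\<And>b. z (0, b) = 1" "\<And>b. z' (0, b) = 0"
    and "\<And>x b. ((\<lambda>x. z (x, b)) has_real_derivative z' (x, b)) (at x)"
    and "\<And>x b. ((\<lambda>x. z' (x, b)) has_real_derivative p (x, b) * z (x, b)) (at x)"
proof -
  let ?h = "picard_term p"
  define z where "z = (\<lambda>xb. \<Sum>n. ?h n xb)"
  note conth = continuous_picard_term[OF p]
  have K: "\<exists>K\<ge>0. \<forall>x b. \<bar>x\<bar> \<le> X \<longrightarrow> \<bar>b\<bar> \<le> X \<longrightarrow> \<bar>p (x, b)\<bar> \<le> K" for X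
  proof -
    have "bounded (p ` ({-X..X} \<times> {-X..X}))"
      by (intro compact_imp_bounded compact_continuous_image continuous_on_subset[OF p] compact_Times) auto
    then obtain K where "K > 0" and K: "\<And>xb. xb \<in> {-X..X} \<times> {-X..X} \<Longrightarrow> norm (p xb) \<le> K"
      unfolding bounded_pos by blast
    then show ?thesis by (intro exI[of _ K]) (auto simp: abs_le_iff)
  qed
  have M: "\<exists>M. summable M \<and> (\<forall>n x b. \<bar>x\<bar> \<le> X \<longrightarrow> \<bar>b\<bar> \<le> X \<longrightarrow> \<bar>?h n (x, b)\<bar> \<le> M n)" for X
  proof -
    obtain K where K0: "K \<ge> 0" and K: "\<And>x b. \<bar>x\<bar> \<le> X \<Longrightarrow> \<bar>b\<bar> \<le> X \<Longrightarrow> \<bar>p (x, b)\<bar> \<le> K"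
      using K[of X] by blast
    have "\<bar>?h n (x, b)\<bar> \<le> (K * X\<^sup>2) ^ n / fact n" if "\<bar>x\<bar> \<le> X" "\<bar>b\<bar> \<le> X" for n x b
    proof -
      have "x\<^sup>2 \<le> X\<^sup>2"
        using that(1) by (simp flip: abs_le_square_iff)
      have "\<bar>?h n (x, b)\<bar> \<le> (K * x\<^sup>2) ^ n / fact n"
        by (rule picard_term_bound[OF p K that])
      also have "(K * x\<^sup>2) ^ n / fact n \<le> (K * X\<^sup>2) ^ n / fact n"
      proof (rule divide_right_mono)
        have "K * x\<^sup>2 \<le> K * X\<^sup>2" using \<open>x\<^sup>2 \<le> X\<^sup>2\<close> K0 by (rule mult_left_mono)
        then show "(K * x\<^sup>2) ^ n \<le> (K * X\<^sup>2) ^ n" using K0 by (intro power_mono) auto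
      qed auto
      finally show ?thesis .
    qed
    moreover have "summable (\<lambda>n. (K * X\<^sup>2) ^ n / fact n)"
      using summable_exp[of "K * X\<^sup>2"] by (simp add: field_simps)
    ultimately show ?thesis by blast
  qed
  have summ: "summable (\<lambda>n. ?h n (x, b))" for x b
  proof -
    obtain M where "summable M" and h: "\<And>n. \<bar>?h n (x, b)\<bar> \<le> M n"
      using M[of "max \<bar>x\<bar> \<bar>b\<bar>"] by (meson max.cobounded1 max.cobounded2)
    show ?thesis
      by (rule summable_comparison_test'[OF \<open>summable M\<close>, of 0]) (simp add: h)
  qed
  have contz: "continuous_on UNIV z"
  proof -
    have "isCont z (x, b)" for x b
    proof -
      define X where "X = max \<bar>x\<bar> \<bar>b\<bar> + 1"
      obtain M where "summable M" and h: "\<And>n x b. \<bar>x\<bar> \<le> X \<Longrightarrow> \<bar>b\<bar> \<le> X \<Longrightarrow> \<bar>?h n (x, b)\<bar> \<le> M n"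
        using M[of X] by blast
      have "uniform_limit ({-X..X} \<times> {-X..X}) (\<lambda>n xb. \<Sum>i<n. ?h i xb) z sequentially"
        unfolding z_def using h
        by (intro Weierstrass_m_test[OF _ \<open>summable M\<close>]) (auto simp: abs_le_iff)
      then have "continuous_on ({-X..X} \<times> {-X..X}) z"
        by (rule uniform_limit_theorem[rotated])
          (auto intro!: always_eventually continuous_on_sum continuous_on_subset[OF conth])
      then have "continuous_on ({-X<..<X} \<times> {-X<..<X}) z"
        by (rule continuous_on_subset) auto
      moreover have "(x, b) \<in> {-X<..<X} \<times> {-X<..<X}" by (auto simp: X_def)
      ultimately show ?thesis
        using continuous_on_eq_continuous_at[OF open_Times[OF open_greaterThanLessThan open_greaterThanLessThan]]
        by blast
    qed
    then show ?thesis by (simp add: continuous_on_eq_continuous_at)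
  qed
  \<comment> \<open>Termwise integration of the uniformly convergent series shifts the index by one;
    the missing term of index 0 is the summand 1.\<close>
  have fixpoint: "z (x, b) = 1 + integral (cbox 0 1) (\<lambda>s. x\<^sup>2 * (1 - s) * p (x * s, b) * z (x * s, b))" for x b
  proof -
    define X where "X = max \<bar>x\<bar> \<bar>b\<bar>"
    obtain K where K0: "K \<ge> 0" and K: "\<And>x b. \<bar>x\<bar> \<le> X \<Longrightarrow> \<bar>b\<bar> \<le> X \<Longrightarrow> \<bar>p (x, b)\<bar> \<le> K"
      using K[of X] by blast
    obtain M where M: "summable M" "\<And>n x b. \<bar>x\<bar> \<le> X \<Longrightarrow> \<bar>b\<bar> \<le> X \<Longrightarrow> \<bar>?h n (x, b)\<bar> \<le> M n"
      using M[of X] by blast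
    let ?g = "\<lambda>n s. x\<^sup>2 * (1 - s) * p (x * s, b) * ?h n (x * s, b)"
    have "norm (?g n s) \<le> x\<^sup>2 * 1 * K * M n" if "s \<in> cbox 0 1" for n s
    proof -
      have s: "0 \<le> s" "s \<le> 1" using that by auto
      then have "\<bar>x * s\<bar> \<le> \<bar>x\<bar>" by (auto simp: abs_mult mult_left_le)
      then have xs: "\<bar>x * s\<bar> \<le> X" "\<bar>b\<bar> \<le> X" by (auto simp: X_def)
      have "norm (?g n s) = x\<^sup>2 * (1 - s) * \<bar>p (x * s, b)\<bar> * \<bar>?h n (x * s, b)\<bar>"
        using s by (simp add: abs_mult)
      also have "\<dots> \<le> x\<^sup>2 * 1 * K * M n"
        using s K[OF xs] M(2)[OF xs] K0 by (intro mult_mono) auto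
      finally show ?thesis .
    qed
    moreover have "summable (\<lambda>n. x\<^sup>2 * 1 * K * M n)" using M(1) by (intro summable_mult)
    ultimately have "uniform_limit (cbox 0 1) (\<lambda>n s. \<Sum>i<n. ?g i s) (\<lambda>s. \<Sum>i. ?g i s) sequentially"
      by (rule Weierstrass_m_test)
    moreover have "(\<Sum>i. ?g i s) = x\<^sup>2 * (1 - s) * p (x * s, b) * z (x * s, b)" for s
      unfolding z_def by (rule suminf_mult[OF summ])
    ultimately have lim: "uniform_limit (cbox 0 1) (\<lambda>n s. \<Sum>i<n. ?g i s)
        (\<lambda>s. x\<^sup>2 * (1 - s) * p (x * s, b) * z (x * s, b)) sequentially" by simp
    note [continuous_intros] = continuous_on_compose2[OF p] continuous_on_compose2[OF conth]
    have contg: "continuous_on (cbox 0 1) (?g i)" for i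
      by (auto intro!: continuous_intros)
    have contsum: "continuous_on (cbox 0 1) (\<lambda>s. \<Sum>i<n. ?g i s)" for n
      by (intro continuous_on_sum contg)
    obtain I J where I: "\<And>n. ((\<lambda>s. \<Sum>i<n. ?g i s) has_integral I n) (cbox 0 1)"
      and J: "((\<lambda>s. x\<^sup>2 * (1 - s) * p (x * s, b) * z (x * s, b)) has_integral J) (cbox 0 1)"
      and IJ: "I \<longlonglongrightarrow> J"
      by (rule uniform_limit_integral_cbox[OF lim contsum trivial_limit_sequentially]) (rule that)
    have "I n = (\<Sum>i<n. ?h (Suc i) (x, b))" for n
    proof -
      have "(?g i has_integral integral (cbox 0 1) (?g i)) (cbox 0 1)" for i
        by (rule integrable_integral[OF integrable_continuous[OF contg]])
      then have "((\<lambda>s. \<Sum>i<n. ?g i s) has_integral (\<Sum>i<n. integral (cbox 0 1) (?g i))) (cbox 0 1)"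
        by (intro has_integral_sum) auto
      then have "I n = (\<Sum>i<n. integral (cbox 0 1) (?g i))"
        by (rule has_integral_unique[OF I])
      then show ?thesis by simp
    qed
    then have "I = (\<lambda>n. \<Sum>i<n. ?h (Suc i) (x, b))" by (rule ext)
    then have "(\<lambda>i. ?h (Suc i) (x, b)) sums J" using IJ by (simp only: sums_def)
    then have "(\<lambda>i. ?h i (x, b)) sums (J + ?h 0 (x, b))" by (rule sums_Suc)
    then have "z (x, b) = 1 + J" unfolding z_def by (simp add: sums_iff)
    then show ?thesis using integral_unique[OF J] by simp
  qed
  note [continuous_intros] = continuous_on_compose2[OF p] continuous_on_compose2[OF contz]
  \<comment> \<open>This is the integral of p z over [0, x] after substituting t = x s, again over a
    fixed interval so that joint continuity is immediate.\<close>
  define z' where "z' = (\<lambda>xb. integral (cbox 0 1) (\<lambda>s. fst xb * (p (fst xb * s, snd xb) * z (fst xb * s, snd xb))))"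
  have "continuous_on UNIV z'"
    unfolding z'_def
    by (intro integral_continuous_on_param) (auto intro!: continuous_intros simp: case_prod_unfold)
  have deriv: "((\<lambda>x. z (x, b)) has_real_derivative z' (x, b)) (at x) \<and>
    ((\<lambda>x. z' (x, b)) has_real_derivative p (x, b) * z (x, b)) (at x)" for b x
  proof -
    let ?g = "\<lambda>t. p (t, b) * z (t, b)"
    have antideriv: "\<exists>F. F 0 = 0 \<and> (\<forall>x. (F has_real_derivative f x) (at x))" if "continuous_on UNIV f" for f :: "real \<Rightarrow> real"
    proof -
      have "\<And>x. isCont f x" using that by (simp add: continuous_on_eq_continuous_at)
      then obtain F where "\<forall>x. (F has_real_derivative f x) (at x)"
        using einterval_antiderivative[of "-\<infinity>" \<infinity> f]
        by (auto simp: has_real_derivative_iff_has_vector_derivative)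
      then show ?thesis
        by (intro exI[of _ "\<lambda>x. F x - F 0"]) (auto intro!: derivative_eq_intros)
    qed
    have contg: "continuous_on UNIV ?g" by (auto intro!: continuous_intros)
    obtain G1 where G1: "G1 0 = 0" "\<And>x. (G1 has_real_derivative ?g x) (at x)"
      using antideriv[OF contg] by blast
    then have "continuous_on UNIV G1"
      by (intro continuous_at_imp_continuous_on ballI DERIV_isCont)
    then obtain G2 where G2: "G2 0 = 0" "\<And>x. (G2 has_real_derivative G1 x) (at x)"
      using antideriv by blast
    have scaled: "((\<lambda>s. G (x * s)) has_real_derivative x * g (x * s)) (at s within T)"
      if "\<And>x. (G has_real_derivative g x) (at x)" for G g :: "real \<Rightarrow> real" and x s T
    proof -
      have "((*) x has_real_derivative x) (at s within T)" by (auto intro!: derivative_eq_intros)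
      from DERIV_chain2[where f = G, OF that this] show ?thesis by (simp add: mult.commute)
    qed
    have z'_eq: "z' (x, b) = G1 x" for x
    proof -
      have "((\<lambda>s. G1 (x * s)) has_real_derivative x * ?g (x * s)) (at s within {0..1})" for s
        by (rule scaled[OF G1(2)])
      then have "((\<lambda>s. x * ?g (x * s)) has_integral (G1 (x * 1) - G1 (x * 0))) {0..1}"
        by (intro fundamental_theorem_of_calculus) (simp_all only: has_real_derivative_iff_has_vector_derivative zero_le_one)
      from integral_unique[OF this] show ?thesis by (simp add: z'_def G1(1) del: integral_mult_right)
    qed
    have z_eq: "z (x, b) = 1 + G2 x" for x
    proof -
      \<comment> \<open>An antiderivative found by integration by parts; at s = 1 it is G2 x and at
        s = 0 it vanishes.\<close>
      let ?F = "\<lambda>s. (1 - s) * x * G1 (x * s) + G2 (x * s)"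
      have "(?F has_real_derivative x\<^sup>2 * (1 - s) * p (x * s, b) * z (x * s, b)) (at s within {0..1})" for s
        by (rule derivative_eq_intros scaled[OF G1(2)] scaled[OF G2(2)] refl)+
          (simp add: algebra_simps power2_eq_square)
      then have "((\<lambda>s. x\<^sup>2 * (1 - s) * p (x * s, b) * z (x * s, b)) has_integral (?F 1 - ?F 0)) {0..1}"
        by (intro fundamental_theorem_of_calculus) (simp_all only: has_real_derivative_iff_has_vector_derivative zero_le_one)
      from integral_unique[OF this] show ?thesis by (simp add: fixpoint[of x b] G1(1) G2(1))
    qed
    show ?thesis
      unfolding z'_eq using G1(2)[of x] DERIV_add[OF DERIV_const G2(2)[of x], of 1] by (simp add: z_eq)
  qed
  have "z (0, b) = 1" "z' (0, b) = 0" for b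
    using fixpoint[of 0 b] by (auto simp: z'_def)
  then show ?thesis
    using that contz \<open>continuous_on UNIV z'\<close> deriv by blast
qed

section \<open>Symmetry and exponential growth of solutions\<close>

lemma DERIV_eq_zero_if_symmetric:
  fixes y :: "real \<Rightarrow> real"
  assumes "\<And>x. (y has_real_derivative y' x) (at x)" "\<And>x. y (2 * c - x) = y x"
  shows "y' c = 0"
proof -
  have "((\<lambda>x. y (2 * c - x)) has_real_derivative y' (2 * c - c) * (- 1)) (at c)"
    by (rule DERIV_chain2[where f = y, OF assms(1)]) (auto intro!: derivative_eq_intros)
  then have "(y has_real_derivative - y' c) (at c)"
    by (simp add: assms(2))
  from DERIV_unique[OF assms(1) this] show ?thesis by simp
qed

text \<open>The difference of the reflected and the original solution solves the same equation with
  zero value and zero slope at c.\<close>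

lemma second_order_linear_ode_symmetric:
  fixes y y' p :: "real \<Rightarrow> real"
  assumes y: "\<And>t. (y has_real_derivative y' t) (at t)"
    and y': "\<And>t. (y' has_real_derivative p t * y t) (at t)"
    and p: "continuous_on UNIV p" "\<And>x. p (2 * c - x) = p x" and c: "y' c = 0"
  shows "y (2 * c - x) = y x"
proof -
  note [derivative_intros] = DERIV_chain2[OF y] DERIV_chain2[OF y']
  have "y (2 * c - x) - y x = 0"
  proof (rule second_order_linear_ode_unique_zero[of "\<lambda>x. y (2 * c - x) - y x" "\<lambda>x. - y' (2 * c - x) - y' x" p c x])
    fix t
    show "((\<lambda>x. y (2 * c - x) - y x) has_real_derivative - y' (2 * c - t) - y' t) (at t)"
      by (auto intro!: derivative_eq_intros)
    show "((\<lambda>x. - y' (2 * c - x) - y' x) has_real_derivative p t * (y (2 * c - t) - y t)) (at t)"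
      by (auto intro!: derivative_eq_intros simp: p(2) right_diff_distrib)
  qed (use c p in auto)
  then show ?thesis by simp
qed

text \<open>Comparison with cosh(\<kappa> x), which also has slope 0 at 0 and solves the equation
  with constant coefficient \<kappa>^2. Working with squares makes the sign of y irrelevant. The 4
  is the square of the 2 lost in replacing the quotient of cosh values by an exponential.\<close>

lemma second_order_linear_ode_growth:
  fixes y y' g :: "real \<Rightarrow> real"
  assumes y: "\<And>t. (y has_real_derivative y' t) (at t)"
    and y': "\<And>t. (y' has_real_derivative g t * y t) (at t)"
    and g: "\<And>t. 0 \<le> t \<Longrightarrow> t \<le> d \<Longrightarrow> \<kappa>\<^sup>2 \<le> g t"
    and "y' 0 = 0" "\<kappa> \<ge> 0" and s: "0 \<le> s" "s \<le> t" "t \<le> d"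
  shows "(y s)\<^sup>2 \<le> 4 * exp (- 2 * \<kappa> * (t - s)) * (y t)\<^sup>2"
proof -
  have tanh: "((\<lambda>x. tanh (\<kappa> * x)) has_real_derivative (1 - (tanh (\<kappa> * x))\<^sup>2) * \<kappa>) (at x)" for x
    by (auto intro!: derivative_eq_intros)
  have cosh: "((\<lambda>x. cosh (\<kappa> * x)) has_real_derivative \<kappa> * (tanh (\<kappa> * x) * cosh (\<kappa> * x))) (at x)" for x
    by (auto intro!: derivative_eq_intros simp: tanh_def)
  \<comment> \<open>Writing \<open>y = cosh (\<kappa> x) v\<close>, the function \<open>P\<close> is \<open>cosh\<^sup>2 (\<kappa> x) v v'\<close>; it is nondecreasing, so \<open>v\<^sup>2\<close> is.\<close>
  define P where "P x = y x * y' x - \<kappa> * tanh (\<kappa> * x) * (y x)\<^sup>2" for x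
  have P': "(P has_real_derivative (y' x - \<kappa> * tanh (\<kappa> * x) * y x)\<^sup>2 + (g x - \<kappa>\<^sup>2) * (y x)\<^sup>2) (at x)" for x
    unfolding P_def by (rule derivative_eq_intros y y' tanh refl)+ (simp add: power2_eq_square algebra_simps)
  have P: "P x \<ge> 0" if "0 \<le> x" "x \<le> d" for x
  proof -
    have "P 0 \<le> P x"
    proof (rule DERIV_nonneg_imp_nondecreasing[OF that(1)])
      fix u assume "0 \<le> u" "u \<le> x"
      then have "0 \<le> (y' u - \<kappa> * tanh (\<kappa> * u) * y u)\<^sup>2 + (g u - \<kappa>\<^sup>2) * (y u)\<^sup>2"
        using g[of u] that(2) by (intro add_nonneg_nonneg mult_nonneg_nonneg) auto
      then show "\<exists>e. (P has_real_derivative e) (at u) \<and> 0 \<le> e" using P' by blast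
    qed
    then show ?thesis by (simp add: P_def \<open>y' 0 = 0\<close>)
  qed
  define V where "V x = (y x / cosh (\<kappa> * x))\<^sup>2" for x
  have V': "(V has_real_derivative 2 * P x / (cosh (\<kappa> * x))\<^sup>2) (at x)" for x
    unfolding V_def by (rule derivative_eq_intros y cosh refl | simp)+
      (simp add: P_def power2_eq_square field_simps)
  have "V s \<le> V t"
  proof (rule DERIV_nonneg_imp_nondecreasing[OF s(2)])
    fix u assume "s \<le> u" "u \<le> t"
    then have "0 \<le> 2 * P u / (cosh (\<kappa> * u))\<^sup>2" using P[of u] s by simp
    then show "\<exists>e. (V has_real_derivative e) (at u) \<and> 0 \<le> e" using V' by blast
  qed
  then have "(y s)\<^sup>2 \<le> (cosh (\<kappa> * s) / cosh (\<kappa> * t))\<^sup>2 * (y t)\<^sup>2"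
    by (simp add: V_def power_divide field_simps)
  also have "\<dots> \<le> (2 * exp (- \<kappa> * (t - s)))\<^sup>2 * (y t)\<^sup>2"
  proof (intro mult_right_mono power_mono)
    have "cosh (\<kappa> * s) / cosh (\<kappa> * t) \<le> exp (\<kappa> * s) / (exp (\<kappa> * t) / 2)"
    proof (rule frac_le)
      have "exp (- (\<kappa> * s)) \<le> exp (\<kappa> * s)" using s \<open>\<kappa> \<ge> 0\<close> by simp
      then show "cosh (\<kappa> * s) \<le> exp (\<kappa> * s)" by (simp add: cosh_def)
      show "exp (\<kappa> * t) / 2 \<le> cosh (\<kappa> * t)" by (simp add: cosh_def)
    qed auto
    also have "\<dots> = 2 * exp (- \<kappa> * (t - s))" by (simp add: exp_diff right_diff_distrib)
    finally show "cosh (\<kappa> * s) / cosh (\<kappa> * t) \<le> 2 * exp (- \<kappa> * (t - s))" .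
  qed auto
  also have "(2 * exp (- \<kappa> * (t - s)))\<^sup>2 = 4 * exp (- 2 * \<kappa> * (t - s))"
    by (simp add: power_mult_distrib flip: exp_double)
  finally show ?thesis .
qed

subsection \<open>Solutions of the Mathieu equations\<close>

text \<open>About pi/2 the equation resembles a harmonic oscillator with frequency 2 sqrt q above
  the bottom -2q, so a lowest parameter of size -2q + O(sqrt q) is to be expected.\<close>

lemma even_periodic_mathieu_solution_exists:
  assumes "q \<ge> 1"
  obtains \<beta> N where "\<beta> \<le> - 2 * q + 8 * sqrt q" "even_periodic_mathieu_solution \<beta> q N"
proof -
  \<comment> \<open>Shooting from the bottom \<open>\<pi>/2\<close> of the potential: \<open>z(\<cdot>, b)\<close> is the solution with parameter \<open>b\<close>, even
    about \<open>\<pi>/2\<close> and shifted there; a zero of \<open>z'(\<pi>/2, \<cdot>)\<close> makes it even about \<open>0\<close> as well.\<close>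
  define p where "p = (\<lambda>(x, b). - 2 * q * cos (2 * x) - b)"
  have "continuous_on UNIV p"
    unfolding p_def case_prod_unfold by (intro continuous_intros)
  note cp = this
  obtain z z' :: "real \<times> real \<Rightarrow> real"
    where contz: "continuous_on UNIV z" and contz': "continuous_on UNIV z'"
      and z0: "\<And>b. z (0, b) = 1" and z'0: "\<And>b. z' (0, b) = 0"
      and z: "\<And>x b. ((\<lambda>x. z (x, b)) has_real_derivative z' (x, b)) (at x)"
      and z': "\<And>x b. ((\<lambda>x. z' (x, b)) has_real_derivative p (x, b) * z (x, b)) (at x)"
    by (rule second_order_linear_ode_parametric_solution[OF cp]) (rule that)
  have contp: "continuous_on UNIV (\<lambda>x. p (x, b))" for b
    unfolding p_def by (auto intro!: continuous_intros)
  have cont_x: "continuous_on A (\<lambda>x. z (x, b))" for A b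
    by (rule continuous_on_compose2[OF contz]) (auto intro!: continuous_intros)
  have cont_b: "continuous_on A (\<lambda>b. z (x, b))" for A x
    by (rule continuous_on_compose2[OF contz]) (auto intro!: continuous_intros)
  have cont_b': "continuous_on A (\<lambda>b. z' (x, b))" for A x
    by (rule continuous_on_compose2[OF contz']) (auto intro!: continuous_intros)
  \<comment> \<open>At \<open>B0\<close> the coefficient p is nonnegative and z has no zero; at
    \<open>B1\<close> oscillation wins and a zero appears. The wanted parameter lies
    between.\<close>
  define B0 B1 where "B0 = - 2 * q" and "B1 = - 2 * q + 8 * sqrt q"
  have zero: "\<exists>t\<in>{0..pi/2}. z (t, b) = 0" if le: "z (x, b) \<le> 0" "0 \<le> x" "x \<le> pi / 2" for x b
  proof -
    obtain t where "0 \<le> t" "t \<le> x" "z (t, b) = 0"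
      using IVT2'[of "\<lambda>x. z (x, b)" x 0 0, OF le(1) _ le(2) cont_x] z0 by auto
    then show ?thesis using le(3) by (intro bexI[of _ t]) auto
  qed
  have "\<exists>x. 0 \<le> x \<and> x \<le> pi / 2 \<and> z (x, B1) \<le> 0"
  proof (rule ccontr)
    assume "\<not> ?thesis"
    then have pos: "z (x, B1) > 0" if "0 \<le> x" "x \<le> pi / 2" for x using that by force
    \<comment> \<open>The frequency is tuned so that p + c^2 is nonpositive up to the first zero
      pi/(2c) of cos(c x): there q x^2 is at most sqrt q, so 4 q (sin x)^2 costs at most 4 sqrt q.
      This and c^2 = 4 sqrt q add up to the 8 sqrt q in \<open>B1\<close>.\<close>
    define c where "c = 2 * sqrt (sqrt q)"
    have "1 \<le> sqrt (sqrt q)" using assms by simp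
    then have "c \<ge> 1" unfolding c_def by linarith
    moreover have "c\<^sup>2 = 4 * sqrt q" using assms by (simp add: c_def power_mult_distrib)
    ultimately have c: "c \<ge> 1" "c\<^sup>2 = 4 * sqrt q" .
    define x1 where "x1 = pi / (2 * c)"
    have x1: "0 < x1" "x1 \<le> pi / 2" "c * x1 = pi / 2"
      using c by (auto simp: x1_def field_simps)
    \<comment> \<open>Sturm comparison with \<open>cos (c x)\<close>.\<close>
    define W where "W x = z' (x, B1) * cos (c * x) + c * z (x, B1) * sin (c * x)" for x
    have W: "(W has_real_derivative (p (x, B1) + c\<^sup>2) * z (x, B1) * cos (c * x)) (at x)" for x
      unfolding W_def by (auto intro!: derivative_eq_intros z z' simp: algebra_simps power2_eq_square)
    have "W x1 \<le> W 0"
    proof (rule DERIV_nonpos_imp_nonincreasing[where f = W])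
      fix x assume x: "0 \<le> x" "x \<le> x1"
      have "q * (sin x)\<^sup>2 \<le> q * x1\<^sup>2"
        using x abs_sin_x_le_abs_x[of x] assms by (intro mult_left_mono) (auto simp flip: abs_le_square_iff)
      also have "\<dots> = q / sqrt q * (pi\<^sup>2 / 16)"
        by (simp add: x1_def power_divide power_mult_distrib c(2))
      also have "\<dots> = sqrt q * (pi\<^sup>2 / 16)"
        using assms by (simp add: real_div_sqrt)
      also have "\<dots> \<le> sqrt q * 1"
        using pi_less_4 assms power_mono[of pi 4 2] by (intro mult_left_mono) auto
      finally have "q * (sin x)\<^sup>2 \<le> sqrt q" by simp
      moreover have "p (x, B1) + c\<^sup>2 = 4 * (q * (sin x)\<^sup>2) - 4 * sqrt q"
        by (simp add: p_def B1_def c(2) cos_double_sin right_diff_distrib)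
      ultimately have "p (x, B1) + c\<^sup>2 \<le> 0" by simp
      moreover have "z (x, B1) > 0" using x x1 pos by auto
      moreover have "cos (c * x) \<ge> 0"
      proof (rule cos_ge_zero)
        have "0 \<le> c * x" "c * x \<le> c * x1" using x c by auto
        then show "- (pi / 2) \<le> c * x" "c * x \<le> pi / 2" using x1(3) pi_gt_zero by linarith+
      qed
      ultimately have "(p (x, B1) + c\<^sup>2) * z (x, B1) * cos (c * x) \<le> 0"
        by (intro mult_nonpos_nonneg) auto
      then show "\<exists>d. (W has_real_derivative d) (at x) \<and> d \<le> 0" using W by blast
    qed (use x1 in auto)
    \<comment> \<open>W vanishes at 0, but at \<open>x1\<close> it equals c z(x1, B1), which is
      positive.\<close>
    then show False using pos[of x1] x1 c z'0 by (simp add: W_def mult_le_0_iff)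
  qed
  then obtain t1 where t1: "t1 \<in> {0..pi/2}" "z (t1, B1) = 0" using zero by blast
  \<comment> \<open>At the smallest parameter \<open>bs\<close> for which a zero occurs in \<open>[0, \<pi>/2]\<close>, the zero sits at \<open>\<pi>/2\<close>.\<close>
  define S where "S = {xb \<in> {0..pi/2} \<times> {B0..B1}. z xb = 0}"
  have "compact S"
  proof -
    have "S = ({0..pi/2} \<times> {B0..B1}) \<inter> (z -` {0} \<inter> UNIV)" by (auto simp: S_def)
    then show ?thesis
      using continuous_on_closed_vimage[of UNIV z] contz
      by (auto intro!: compact_Int_closed compact_Times)
  qed
  moreover have "(t1, B1) \<in> S" using t1 assms by (auto simp: S_def B0_def B1_def)
  ultimately obtain xs bs where xsbs: "(xs, bs) \<in> S" and min: "\<And>x b. (x, b) \<in> S \<Longrightarrow> bs \<le> b"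
    using continuous_attains_inf[of S snd] continuous_on_snd[OF continuous_on_id] by force
  then have xs: "0 \<le> xs" "xs \<le> pi / 2" and bs: "B0 \<le> bs" "bs \<le> B1" and zs: "z (xs, bs) = 0"
    by (auto simp: S_def)
  have pos: "z (x, b) > 0" if xb: "B0 \<le> b" "b < bs" "0 \<le> x" "x \<le> pi / 2" for x b
  proof (rule ccontr)
    assume "\<not> z (x, b) > 0"
    then have "\<exists>t\<in>{0..pi/2}. z (t, b) = 0" by (intro zero[OF _ xb(3,4)]) simp
    then obtain t where "t \<in> {0..pi/2}" "z (t, b) = 0" by blast
    then have "(t, b) \<in> S" using xb bs by (auto simp: S_def)
    from min[OF this] show False using xb by simp
  qed
  \<comment> \<open>Used twice: it excludes zeros at \<open>B0\<close>, and it fixes the sign of z'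
    at pi/2 for the final intermediate value argument.\<close>
  have zz': "z (x, B0) * z' (x, B0) \<ge> 0" if "0 \<le> x" for x
  proof -
    have "z (0, B0) * z' (0, B0) \<le> z (x, B0) * z' (x, B0)"
    proof (rule DERIV_nonneg_imp_nondecreasing[OF that, where f = "\<lambda>x. z (x, B0) * z' (x, B0)"])
      fix x :: real
      have "p (x, B0) \<ge> 0" using assms by (simp add: p_def B0_def)
      then have "(z' (x, B0))\<^sup>2 + p (x, B0) * (z (x, B0))\<^sup>2 \<ge> 0" by simp
      moreover have "((\<lambda>x. z (x, B0) * z' (x, B0)) has_real_derivative (z' (x, B0))\<^sup>2 + p (x, B0) * (z (x, B0))\<^sup>2) (at x)"
        by (auto intro!: derivative_eq_intros z z' simp: algebra_simps power2_eq_square)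
      ultimately show "\<exists>d. ((\<lambda>x. z (x, B0) * z' (x, B0)) has_real_derivative d) (at x) \<and> 0 \<le> d"
        by blast
    qed
    then show ?thesis by (simp add: z'0)
  qed
  have "B0 < bs"
  proof (rule ccontr)
    assume "\<not> B0 < bs"
    then have "bs = B0" using bs by simp
    have "(z (0, B0))\<^sup>2 \<le> (z (xs, B0))\<^sup>2"
    proof (rule DERIV_nonneg_imp_nondecreasing[OF xs(1), where f = "\<lambda>x. (z (x, B0))\<^sup>2"])
      fix x :: real assume "0 \<le> x"
      moreover have "((\<lambda>x. (z (x, B0))\<^sup>2) has_real_derivative 2 * (z (x, B0) * z' (x, B0))) (at x)"
        by (auto intro!: derivative_eq_intros z)
      ultimately show "\<exists>d. ((\<lambda>x. (z (x, B0))\<^sup>2) has_real_derivative d) (at x) \<and> 0 \<le> d"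
        using zz'[of x] by (intro exI[of _ "2 * (z (x, B0) * z' (x, B0))"]) simp
    qed
    then show False using zs \<open>bs = B0\<close> by (simp add: z0)
  qed
  have nonneg: "z (x, bs) \<ge> 0" if x: "0 \<le> x" "x \<le> pi / 2" for x
  proof (rule tendsto_lowerbound)
    show "((\<lambda>b. z (x, b)) \<longlongrightarrow> z (x, bs)) (at_left bs)"
      using cont_b[of UNIV x] by (simp add: continuous_on_eq_continuous_at isCont_def filterlim_at_split)
    show "\<forall>\<^sub>F b in at_left bs. 0 \<le> z (x, b)"
      using eventually_at_left_real[OF \<open>B0 < bs\<close>]
      by (rule eventually_mono) (auto intro!: less_imp_le pos x)
  qed auto
  \<comment> \<open>z(., bs) is a limit of functions positive on [0, pi/2], so a zero inside the
    interval would be a minimum, hence a double zero, and z would vanish identically.\<close>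
  have "xs = pi / 2"
  proof (rule ccontr)
    assume "xs \<noteq> pi / 2"
    moreover have "xs \<noteq> 0" using zs z0 by auto
    ultimately have "0 < min xs (pi / 2 - xs)" using xs by auto
    then have "z' (xs, bs) = 0"
      by (rule DERIV_local_min[OF z]) (use nonneg zs in \<open>auto simp: abs_if split: if_splits\<close>)
    then have "z (0, bs) = 0"
      using second_order_linear_ode_unique_zero[OF z z' contp zs] by blast
    then show False using z0 by simp
  qed
  have "z' (pi / 2, bs) \<le> 0"
  proof (rule ccontr)
    assume "\<not> ?thesis"
    then have "0 < z' (pi / 2, bs)" by simp
    from DERIV_pos_inc_left[OF z this]
    obtain d where "d > 0" and d: "\<forall>h>0. h < d \<longrightarrow> z (pi / 2 - h, bs) < z (pi / 2, bs)" by blast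
    define h where "h = min (d / 2) (pi / 2)"
    have h: "0 < h" "h < d" "h \<le> pi / 2" using \<open>d > 0\<close> by (auto simp: h_def min_less_iff_disj)
    then have "z (pi / 2 - h, bs) < 0" using d zs \<open>xs = pi / 2\<close> by simp
    then show False using nonneg[of "pi / 2 - h"] h by simp
  qed
  moreover have "z' (pi / 2, B0) \<ge> 0"
    using zz'[of "pi / 2"] pos[of B0 "pi / 2"] \<open>B0 < bs\<close> by (auto simp: zero_le_mult_iff)
  ultimately have "\<exists>b\<ge>B0. b \<le> bs \<and> z' (pi / 2, b) = 0"
    using \<open>B0 < bs\<close> cont_b' by (intro IVT2') auto
  then obtain b where b: "B0 \<le> b" "b \<le> bs" "z' (pi / 2, b) = 0" by blast
  define y where "y x = z (x, b)" for x
  have y_even: "y (- x) = y x" for x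
    using second_order_linear_ode_symmetric[OF z z' contp, of 0] z'0 by (simp add: p_def y_def)
  have y_refl: "y (pi - x) = y x" for x
    using second_order_linear_ode_symmetric[OF z z' contp, of "pi / 2"] b(3)
    by (simp add: p_def y_def right_diff_distrib)
  \<comment> \<open>The reflections in 0 and in pi/2 compose to the translation by pi.\<close>
  have y_period: "y (x + pi) = y x" for x
    using y_refl[of "- x"] y_even[of x] by (simp add: add.commute)
  have "even_periodic_mathieu_solution b q (\<lambda>\<nu>. y (\<nu> - pi / 2))"
    unfolding even_periodic_mathieu_solution_def mathieu_solution_def
  proof (intro conjI exI allI)
    fix \<nu>
    note [derivative_intros] = DERIV_chain2[OF z] DERIV_chain2[OF z']
    show "((\<lambda>\<nu>. y (\<nu> - pi / 2)) has_real_derivative z' (\<nu> - pi / 2, b)) (at \<nu>)"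
      unfolding y_def by (auto intro!: derivative_eq_intros)
    show "((\<lambda>\<nu>. z' (\<nu> - pi / 2, b)) has_real_derivative
        (p (\<nu> - pi / 2, b) * z (\<nu> - pi / 2, b))) (at \<nu>)"
      by (auto intro!: derivative_eq_intros)
    show "p (\<nu> - pi / 2, b) * z (\<nu> - pi / 2, b) + (b - 2 * q * cos (2 * \<nu>)) * y (\<nu> - pi / 2) = 0"
      by (simp add: p_def y_def right_diff_distrib cos_diff algebra_simps)
    show "y (pi / 2 - pi / 2) \<noteq> 0" by (simp add: y_def z0)
    show "y (- \<nu> - pi / 2) = y (\<nu> - pi / 2)"
      using y_even[of "\<nu> + pi / 2"] y_period[of "\<nu> - pi / 2"] by (simp add: algebra_simps)
    show "y (\<nu> + 2 * pi - pi / 2) = y (\<nu> - pi / 2)"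
      using y_period[of "\<nu> - pi / 2"] y_period[of "\<nu> - pi / 2 + pi"] by (simp add: algebra_simps)
  qed
  moreover have "b \<le> - 2 * q + 8 * sqrt q" using b bs by (simp add: B1_def)
  ultimately show ?thesis using that by blast
qed

text \<open>Otherwise N'' = p N with p > 0, so N N' is strictly increasing wherever N and N' are not
  both 0; yet it vanishes at 0 and pi by symmetry, against Rolle's theorem. The bound serves to
  control the coefficient of the modified equation when q is bounded.\<close>

lemma mathieu_eigenvalue_lower_bound:
  assumes N: "even_periodic_mathieu_solution \<alpha> q N" and "q \<ge> 0"
  shows "- 2 * q \<le> \<alpha>"
proof (rule ccontr)
  assume less: "\<not> - 2 * q \<le> \<alpha>"
  from N obtain N' N'' where N': "\<And>\<nu>. (N has_real_derivative N' \<nu>) (at \<nu>)"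
    and N'': "\<And>\<nu>. (N' has_real_derivative N'' \<nu>) (at \<nu>)"
    and eq: "\<And>\<nu>. N'' \<nu> + (\<alpha> - 2 * q * cos (2 * \<nu>)) * N \<nu> = 0"
    unfolding even_periodic_mathieu_solution_def mathieu_solution_def by blast
  from N have even: "\<And>\<nu>. N (- \<nu>) = N \<nu>" and period: "\<And>\<nu>. N (\<nu> + 2 * pi) = N \<nu>"
    and nz: "\<exists>\<nu>. N \<nu> \<noteq> 0"
    unfolding even_periodic_mathieu_solution_def by blast+
  define p where "p \<nu> = 2 * q * cos (2 * \<nu>) - \<alpha>" for \<nu>
  have N''_eq: "N'' \<nu> = p \<nu> * N \<nu>" for \<nu> using eq[of \<nu>] by (simp add: p_def algebra_simps)
  have p: "p \<nu> > 0" for \<nu>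
  proof -
    have "q * - 1 \<le> q * cos (2 * \<nu>)" using \<open>q \<ge> 0\<close> by (intro mult_left_mono) auto
    then show ?thesis using less by (simp add: p_def)
  qed
  have "N' 0 = 0" by (rule DERIV_eq_zero_if_symmetric[OF N']) (simp add: even)
  moreover have "N' pi = 0"
  proof (rule DERIV_eq_zero_if_symmetric[OF N'])
    show "N (2 * pi - x) = N x" for x using period[of "- x"] even[of x] by (simp add: algebra_simps)
  qed
  moreover have D: "((\<lambda>\<nu>. N \<nu> * N' \<nu>) has_real_derivative (N' \<nu>)\<^sup>2 + p \<nu> * (N \<nu>)\<^sup>2) (at \<nu>)" for \<nu>
    by (rule derivative_eq_intros N' N'')+ (simp add: N''_eq power2_eq_square)
  ultimately obtain \<nu> where "(N' \<nu>)\<^sup>2 + p \<nu> * (N \<nu>)\<^sup>2 = 0"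
    using Rolle_deriv[of 0 pi "\<lambda>\<nu>. N \<nu> * N' \<nu>" "\<lambda>\<nu> h. ((N' \<nu>)\<^sup>2 + p \<nu> * (N \<nu>)\<^sup>2) * h"]
      DERIV_isCont[OF D]
    by (auto simp: has_field_derivative_def fun_eq_iff continuous_at_imp_continuous_on dest: spec[of _ 1])
  moreover have "p \<nu> * (N \<nu>)\<^sup>2 \<ge> 0" using p[of \<nu>] by simp
  ultimately have "N' \<nu> = 0" "N \<nu> = 0"
    using p[of \<nu>] by (auto simp: add_nonneg_eq_0_iff)
  moreover have "continuous_on UNIV p" unfolding p_def by (intro continuous_intros)
  ultimately have "N x = 0" for x
    using second_order_linear_ode_unique_zero[OF N', of p \<nu> x] N'' by (simp add: N''_eq)
  then show False using nz by blast
qed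

text \<open>Seen from either direction c, with either orientation s, N solves the same equation with
  slope 0 at the start, as N is symmetric about 0 and pi. The coefficient is 4 q (cos t)^2 - 2 q -
  \<alpha>, smallest at the outer end \<nu>1.\<close>

lemma even_periodic_mathieu_solution_growth:
  assumes N: "even_periodic_mathieu_solution \<alpha> q N" and \<alpha>: "\<alpha> \<le> - 2 * q + 8 * sqrt q"
    and \<kappa>: "\<kappa> \<ge> 0" "\<kappa>\<^sup>2 \<le> 4 * q * (cos \<nu>1)\<^sup>2 - 8 * sqrt q" and "q \<ge> 0" "\<nu>1 \<le> pi / 2"
    and cs: "c \<in> {0, pi}" "s \<in> {1, - 1}" and x: "0 \<le> x" "x \<le> y" "y \<le> \<nu>1"
  shows "(N (c + s * x))\<^sup>2 \<le> 4 * exp (- 2 * \<kappa> * (y - x)) * (N (c + s * y))\<^sup>2"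
proof -
  from N obtain N' N'' where N': "\<And>\<nu>. (N has_real_derivative N' \<nu>) (at \<nu>)"
    and N'': "\<And>\<nu>. (N' has_real_derivative N'' \<nu>) (at \<nu>)"
    and eq: "\<And>\<nu>. N'' \<nu> + (\<alpha> - 2 * q * cos (2 * \<nu>)) * N \<nu> = 0"
    unfolding even_periodic_mathieu_solution_def mathieu_solution_def by blast
  from N have even: "\<And>\<nu>. N (- \<nu>) = N \<nu>" and period: "\<And>\<nu>. N (\<nu> + 2 * pi) = N \<nu>"
    unfolding even_periodic_mathieu_solution_def by blast+
  have N''_eq: "N'' \<nu> = (2 * q * cos (2 * \<nu>) - \<alpha>) * N \<nu>" for \<nu>
    using eq[of \<nu>] by (simp add: algebra_simps)
  have lin: "((\<lambda>x. c + s * x) has_real_derivative s) (at x)" for x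
    by (auto intro!: derivative_eq_intros)
  have ss: "s * s = 1" using cs by auto
  have cos_eq: "cos (2 * (c + s * x)) = cos (2 * x)" for x
    using cs by (auto simp: cos_add distrib_left)
  show ?thesis
  proof (rule second_order_linear_ode_growth[where y = "\<lambda>x. N (c + s * x)" and y' = "\<lambda>x. N' (c + s * x) * s"
        and g = "\<lambda>x. 2 * q * cos (2 * x) - \<alpha>", OF _ _ _ _ \<kappa>(1) x])
    fix t
    show "((\<lambda>x. N (c + s * x)) has_real_derivative N' (c + s * t) * s) (at t)"
      by (rule DERIV_chain2[where f = N, OF N' lin])
    have "((\<lambda>x. N' (c + s * x) * s) has_real_derivative N'' (c + s * t) * s * s) (at t)"
      by (rule DERIV_cmult_right[OF DERIV_chain2[where f = N', OF N'' lin]])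
    then show "((\<lambda>x. N' (c + s * x) * s) has_real_derivative (2 * q * cos (2 * t) - \<alpha>) * N (c + s * t)) (at t)"
      unfolding N''_eq cos_eq mult.assoc ss by simp
    show "\<kappa>\<^sup>2 \<le> 2 * q * cos (2 * t) - \<alpha>" if t: "0 \<le> t" "t \<le> \<nu>1"
    proof -
      have "0 \<le> cos \<nu>1" "cos \<nu>1 \<le> cos t"
        using t \<open>\<nu>1 \<le> pi / 2\<close> by (auto intro!: cos_ge_zero cos_monotone_0_pi_le)
      then have "q * (cos \<nu>1)\<^sup>2 \<le> q * (cos t)\<^sup>2" using \<open>q \<ge> 0\<close> by (intro mult_left_mono power_mono)
      then show ?thesis using \<kappa>(2) \<alpha> by (simp add: cos_double_cos right_diff_distrib)
    qed
  next
    have "N' c = 0"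
    proof (rule DERIV_eq_zero_if_symmetric[OF N'])
      show "N (2 * c - x) = N x" for x
        using cs period[of "- x"] even[of x] by (auto simp: algebra_simps)
    qed
    then show "N' (c + s * 0) * s = 0" by simp
  qed
qed

text \<open>Since g is at most K^2, M^2 cannot fall from its maximum between two zeros down to 0
  within a distance shorter than 1/K. A function with m zeros in a fixed interval therefore forces q
  to be large.\<close>

lemma modified_mathieu_zeros_bound:
  assumes M: "modified_mathieu_solution \<alpha> q M" and \<alpha>: "- 2 * q \<le> \<alpha>"
    and q: "0 \<le> q" "q \<le> Q" and "0 < b"
    and fin: "finite {\<mu>. 0 < \<mu> \<and> \<mu> < b \<and> M \<mu> = 0}"
  shows "real (card {\<mu>. 0 < \<mu> \<and> \<mu> < b \<and> M \<mu> = 0}) \<le> (2 * Q * cosh (2 * b) + 2 * Q + 1) * b + 1"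
proof -
  let ?Z = "{\<mu>. 0 < \<mu> \<and> \<mu> < b \<and> M \<mu> = 0}"
  \<comment> \<open>The summand 1 makes K at least 1, so a bound of g by K is also a bound by
    K^2.\<close>
  define K where "K = 2 * Q * cosh (2 * b) + 2 * Q + 1"
  have "K \<ge> 1" using q by (simp add: K_def)
  from M obtain M' M'' where M': "\<And>\<mu>. (M has_real_derivative M' \<mu>) (at \<mu>)"
    and M'': "\<And>\<mu>. (M' has_real_derivative M'' \<mu>) (at \<mu>)"
    and eq: "\<And>\<mu>. M'' \<mu> - (\<alpha> - 2 * q * cosh (2 * \<mu>)) * M \<mu> = 0"
    unfolding modified_mathieu_solution_def by blast
  define g where "g \<mu> = 2 * q * cosh (2 * \<mu>) - \<alpha>" for \<mu>
  have M''_eq: "M'' \<mu> = - g \<mu> * M \<mu>" for \<mu> using eq[of \<mu>] by (simp add: g_def algebra_simps)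
  have g: "g \<mu> \<le> K\<^sup>2" if "0 \<le> \<mu>" "\<mu> \<le> b" for \<mu>
  proof -
    have "2 * q * cosh (2 * \<mu>) \<le> 2 * Q * cosh (2 * b)"
      using that q by (intro mult_mono) (auto simp: cosh_real_nonneg_le_iff)
    then have "g \<mu> \<le> K" using \<alpha> q by (simp add: g_def K_def)
    also have "K \<le> K\<^sup>2" using \<open>K \<ge> 1\<close> by (simp add: power2_eq_square)
    finally show ?thesis .
  qed
  define w where "w \<mu> = (M \<mu>)\<^sup>2" for \<mu>
  have w': "(w has_real_derivative 2 * M \<mu> * M' \<mu>) (at \<mu>)" for \<mu>
    unfolding w_def by (rule derivative_eq_intros M' refl)+ simp
  have gap: "1 \<le> K * (v - u)" if uv: "u \<in> ?Z" "v \<in> ?Z" "u < v" for u v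
  proof (rule ccontr)
    assume "\<not> ?thesis"
    then have small: "K * (v - u) < 1" by simp
    have "continuous_on {u..v} w"
      using w' by (intro continuous_at_imp_continuous_on ballI DERIV_isCont)
    then obtain c where c: "c \<in> {u..v}" and max: "\<And>x. x \<in> {u..v} \<Longrightarrow> w x \<le> w c"
      using continuous_attains_sup[of "{u..v}" w] uv by force
    \<comment> \<open>Finiteness of the zero set excludes that M vanishes on all of [u, v].\<close>
    have "w c > 0"
    proof (rule ccontr)
      assume "\<not> w c > 0"
      then have "w x \<le> 0" if "x \<in> {u..v}" for x using max[OF that] by simp
      then have "{u..v} \<subseteq> ?Z" using uv by (auto simp: w_def)
      then show False using fin uv(3) finite_subset infinite_Icc by blast
    qed
    then have "c \<noteq> u" "c \<noteq> v" using uv by (auto simp: w_def)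
    with c have "0 < min (c - u) (v - c)" by auto
    then have c': "2 * M c * M' c = 0"
      by (rule DERIV_local_max[OF w']) (use max in \<open>auto simp: abs_if split: if_splits\<close>)
    \<comment> \<open>h is the derivative of w + K^2 w(c) (x - c)^2, a function that is thus
      nondecreasing to the right of the maximum c.\<close>
    define h where "h x = 2 * M x * M' x + 2 * K\<^sup>2 * w c * (x - c)" for x
    have h': "(h has_real_derivative 2 * (M' x)\<^sup>2 - 2 * g x * w x + 2 * K\<^sup>2 * w c) (at x)" for x
      unfolding h_def by (rule derivative_eq_intros M' M'' refl)+ (simp add: M''_eq w_def power2_eq_square algebra_simps)
    have h: "h x \<ge> 0" if "c \<le> x" "x \<le> v" for x
    proof -
      have "h c \<le> h x"
      proof (rule DERIV_nonneg_imp_nondecreasing[OF that(1)])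
        fix t assume t: "c \<le> t" "t \<le> x"
        have "g t * w t \<le> K\<^sup>2 * w c"
        proof (rule order_trans)
          show "g t * w t \<le> K\<^sup>2 * w t"
            using g[of t] t that uv c by (intro mult_right_mono) (auto simp: w_def)
          show "K\<^sup>2 * w t \<le> K\<^sup>2 * w c"
            using max[of t] t that c by (intro mult_left_mono) auto
        qed
        then have "0 \<le> 2 * (M' t)\<^sup>2 - 2 * g t * w t + 2 * K\<^sup>2 * w c"
          using zero_le_power2[of "M' t"] by linarith
        then show "\<exists>d. (h has_real_derivative d) (at t) \<and> 0 \<le> d" using h' by blast
      qed
      then show ?thesis using c' by (simp add: h_def)
    qed
    have "w c + K\<^sup>2 * w c * (c - c)\<^sup>2 \<le> w v + K\<^sup>2 * w c * (v - c)\<^sup>2"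
    proof (rule DERIV_nonneg_imp_nondecreasing[where f = "\<lambda>x. w x + K\<^sup>2 * w c * (x - c)\<^sup>2"])
      fix t assume t: "c \<le> t" "t \<le> v"
      have "((\<lambda>x. w x + K\<^sup>2 * w c * (x - c)\<^sup>2) has_real_derivative h t) (at t)"
        by (rule derivative_eq_intros w' refl)+ (simp add: h_def)
      then show "\<exists>d. ((\<lambda>x. w x + K\<^sup>2 * w c * (x - c)\<^sup>2) has_real_derivative d) (at t) \<and> 0 \<le> d"
        using h[OF t] by blast
    qed (use c in auto)
    also have "w v = 0" using uv by (simp add: w_def)
    finally have "w c * 1 \<le> w c * (K * (v - c))\<^sup>2" by (simp add: power_mult_distrib mult_ac)
    then have "1 \<le> (K * (v - c))\<^sup>2" using \<open>w c > 0\<close> by (simp only: mult_le_cancel_left_pos)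
    moreover have "0 \<le> K * (v - c)" "K * (v - c) \<le> K * (v - u)" using c \<open>K \<ge> 1\<close> by auto
    then have "(K * (v - c))\<^sup>2 < 1" using small by (simp add: power_less_one_iff abs_square_less_1)
    ultimately show False by simp
  qed
  \<comment> \<open>Zeros at distance at least 1/K fall into different cells of length 1/K; cell 0
    accounts for the final + 1.\<close>
  have "inj_on (\<lambda>\<mu>. nat \<lfloor>K * \<mu>\<rfloor>) ?Z"
  proof (rule linorder_inj_onI)
    fix u v assume uv: "u < v" "u \<in> ?Z" "v \<in> ?Z"
    then have "K * u + 1 \<le> K * v" using gap[of u v] by (simp add: right_diff_distrib)
    then have "\<lfloor>K * u\<rfloor> < \<lfloor>K * v\<rfloor>" by linarith
    moreover have "0 \<le> \<lfloor>K * u\<rfloor>" using uv \<open>K \<ge> 1\<close> by simp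
    ultimately show "nat \<lfloor>K * u\<rfloor> \<noteq> nat \<lfloor>K * v\<rfloor>" by linarith
  qed auto
  moreover have "(\<lambda>\<mu>. nat \<lfloor>K * \<mu>\<rfloor>) ` ?Z \<subseteq> {..nat \<lfloor>K * b\<rfloor>}"
    using \<open>K \<ge> 1\<close> by (auto intro!: nat_mono floor_mono)
  ultimately have "card ?Z \<le> card {..nat \<lfloor>K * b\<rfloor>}" by (intro card_inj_on_le) auto
  then have "real (card ?Z) \<le> real (nat \<lfloor>K * b\<rfloor>) + 1" by simp
  also have "real (nat \<lfloor>K * b\<rfloor>) \<le> K * b" using \<open>K \<ge> 1\<close> \<open>0 < b\<close> by simp
  finally show ?thesis by (simp add: K_def)
qed

subsection \<open>Elliptical coordinates\<close>

lemma elliptic_point_eqD: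
  assumes "a > 0" "\<mu> \<ge> 0" "\<mu>' \<ge> 0" and eq: "elliptic_point a \<mu> \<nu> = elliptic_point a \<mu>' \<nu>'"
  shows "\<mu> = \<mu>' \<and> (\<exists>n::int. \<nu> = \<nu>' + of_int n * (2 * pi) \<or> (\<mu> = 0 \<and> \<nu> = - \<nu>' + of_int n * (2 * pi)))"
proof -
  have "cosh \<mu> * cos \<nu> = cosh \<mu>' * cos \<nu>'" "sinh \<mu> * sin \<nu> = sinh \<mu>' * sin \<nu>'"
    using arg_cong[OF eq, of "\<lambda>x. x $ 1"] arg_cong[OF eq, of "\<lambda>x. x $ 2"] \<open>a > 0\<close>
    by (simp_all add: elliptic_point_def)
  \<comment> \<open>\<open>elliptic_point a\<close> is \<open>a\<close> times the complex cosine of \<open>\<nu> - i \<mu>\<close>, up to the sign of \<open>i\<close>.\<close>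
  then have "cos (Complex \<nu> (- \<mu>)) = cos (Complex \<nu>' (- \<mu>'))"
    by (intro complex_eqI) (simp_all add: Re_cos Im_cos cosh_field_def sinh_field_def algebra_simps)
  then obtain r where "r \<in> \<int>"
    and "Complex \<nu> (- \<mu>) = Complex \<nu>' (- \<mu>') + of_real (2 * r * pi) \<or>
      Complex \<nu> (- \<mu>) = - Complex \<nu>' (- \<mu>') + of_real (2 * r * pi)"
    unfolding complex_cos_eq by blast
  then consider "\<nu> = \<nu>' + 2 * r * pi" "\<mu> = \<mu>'" | "\<nu> = - \<nu>' + 2 * r * pi" "\<mu> = - \<mu>'"
    by (auto simp: complex_eq_iff)
  moreover obtain n :: int where "r = of_int n" using \<open>r \<in> \<int>\<close> by (auto elim: Ints_cases)
  ultimately show ?thesis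
  proof cases
    case 1
    then show ?thesis using \<open>r = of_int n\<close> by (intro conjI exI[of _ n]) (auto simp: mult_ac)
  next
    case 2
    then have "\<mu> = 0" "\<mu>' = 0" using assms by auto
    then show ?thesis using 2 \<open>r = of_int n\<close> by (intro conjI exI[of _ n]) (auto simp: mult_ac)
  qed
qed

lemma elliptic_product_elliptic_point:
  assumes "a > 0" "\<mu> \<ge> 0" and even: "\<And>x. N (- x) = N x" and period: "\<And>x. N (x + 2 * pi) = N x"
  shows "elliptic_product a M N (elliptic_point a \<mu> \<nu>) = M \<mu> * N \<nu>"
proof -
  interpret N: periodic_fun_simple N "2 * pi" by standard (rule period)
  interpret E: periodic_fun_simple "elliptic_point a \<mu>" "2 * pi"
    by standard (simp add: elliptic_point_def)
  define n where "n = \<lfloor>\<nu> / (2 * pi)\<rfloor>"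
  define \<nu>' where "\<nu>' = \<nu> - of_int n * (2 * pi)"
  have "of_int n \<le> \<nu> / (2 * pi)" "\<nu> / (2 * pi) < of_int n + 1" unfolding n_def by linarith+
  then have \<nu>': "0 \<le> \<nu>'" "\<nu>' < 2 * pi" by (simp_all add: \<nu>'_def field_simps)
  have N: "N \<nu>' = N \<nu>" and E: "elliptic_point a \<mu> \<nu>' = elliptic_point a \<mu> \<nu>"
    by (simp_all only: \<nu>'_def N.minus_of_int E.minus_of_int)
  show ?thesis
    unfolding elliptic_product_def
  proof (rule the_equality)
    show "\<exists>\<mu>' x. 0 \<le> \<mu>' \<and> 0 \<le> x \<and> x < 2 * pi \<and>
        elliptic_point a \<mu> \<nu> = elliptic_point a \<mu>' x \<and> M \<mu> * N \<nu> = M \<mu>' * N x"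
      using \<open>\<mu> \<ge> 0\<close> \<nu>' N E by metis
  next
    fix v assume "\<exists>\<mu>' x. 0 \<le> \<mu>' \<and> 0 \<le> x \<and> x < 2 * pi \<and>
        elliptic_point a \<mu> \<nu> = elliptic_point a \<mu>' x \<and> v = M \<mu>' * N x"
    then obtain \<mu>' x where *: "0 \<le> \<mu>'" "elliptic_point a \<mu> \<nu> = elliptic_point a \<mu>' x" "v = M \<mu>' * N x"
      by blast
    from elliptic_point_eqD[OF assms(1,2) *(1,2)] obtain m :: int
      where "\<mu> = \<mu>'" "\<nu> = x + of_int m * (2 * pi) \<or> \<nu> = - x + of_int m * (2 * pi)" by blast
    then show "v = M \<mu> * N \<nu>" using *(3) N.plus_of_int[of x m] N.plus_of_int[of "- x" m] even[of x] by auto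
  qed
qed

section \<open>Charts and area integrals\<close>

text \<open>With c in {0, pi} and s = 1 or -1 this parametrizes the four halves of the two sector
  components; a shifted c and a rescaled s give the strips they are compared with, over the same
  box.\<close>

definition elliptic_chart :: "real \<Rightarrow> real \<Rightarrow> real \<Rightarrow> real^2 \<Rightarrow> real^2" where
  "elliptic_chart a c s p = elliptic_point a (p $ 1) (c + s * p $ 2)"

definition elliptic_chart_deriv :: "real \<Rightarrow> real \<Rightarrow> real \<Rightarrow> real^2 \<Rightarrow> real^2 \<Rightarrow> real^2" where
  "elliptic_chart_deriv a c s p h = vector
     [a * (sinh (p $ 1) * cos (c + s * p $ 2) * h $ 1 - s * cosh (p $ 1) * sin (c + s * p $ 2) * h $ 2),
      a * (cosh (p $ 1) * sin (c + s * p $ 2) * h $ 1 + s * sinh (p $ 1) * cos (c + s * p $ 2) * h $ 2)]"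

lemma has_derivative_elliptic_chart:
  "(elliptic_chart a c s has_derivative elliptic_chart_deriv a c s p) (at p within S)"
proof (subst has_derivative_componentwise_within, rule ballI)
  have nth: "((\<lambda>p::real^2. p $ k) has_derivative (\<lambda>h. h $ k)) (at p within S)" for k
    by (rule bounded_linear_imp_has_derivative[OF bounded_linear_vec_nth])
  have cosh: "((\<lambda>p. cosh (p $ 1)) has_derivative (\<lambda>h. h $ 1 * sinh (p $ 1))) (at p within S)"
    and sinh: "((\<lambda>p. sinh (p $ 1)) has_derivative (\<lambda>h. h $ 1 * cosh (p $ 1))) (at p within S)"
    by (rule DERIV_compose_FDERIV[OF _ nth], auto intro!: derivative_eq_intros)+
  fix i :: "real^2" assume "i \<in> Basis"
  then obtain k where i: "i = axis k 1" by (auto simp: Basis_vec_def)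
  have "k = 1 \<or> k = 2" by (rule exhaust_2)
  then show "((\<lambda>x. elliptic_chart a c s x \<bullet> i) has_derivative (\<lambda>x. elliptic_chart_deriv a c s p x \<bullet> i)) (at p within S)"
    unfolding i inner_axis elliptic_chart_def elliptic_point_def elliptic_chart_deriv_def
    by (auto intro!: derivative_eq_intros nth cosh sinh simp: fun_eq_iff algebra_simps)
qed

lemma abs_det_elliptic_chart_deriv:
  "\<bar>det (matrix (elliptic_chart_deriv a c s p))\<bar> =
     \<bar>s\<bar> * (a\<^sup>2 * ((sinh (p $ 1))\<^sup>2 + (sin (c + s * p $ 2))\<^sup>2))"
proof -
  have "det (matrix (elliptic_chart_deriv a c s p)) = s * (a\<^sup>2 *
     ((sinh (p $ 1))\<^sup>2 * (cos (c + s * p $ 2))\<^sup>2 + (cosh (p $ 1))\<^sup>2 * (sin (c + s * p $ 2))\<^sup>2))"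
    by (simp add: det_2 matrix_def elliptic_chart_deriv_def axis_def power2_eq_square algebra_simps)
  also have "(sinh (p $ 1))\<^sup>2 * (cos (c + s * p $ 2))\<^sup>2 + (cosh (p $ 1))\<^sup>2 * (sin (c + s * p $ 2))\<^sup>2
      = (sinh (p $ 1))\<^sup>2 + (sin (c + s * p $ 2))\<^sup>2"
    unfolding cos_squared_eq cosh_square_eq by (simp add: algebra_simps)
  finally show ?thesis by (simp add: abs_mult)
qed

lemma inj_on_elliptic_chart:
  assumes "a > 0" "s \<noteq> 0" "\<bar>s\<bar> * d \<le> 2 * pi"
  shows "inj_on (elliptic_chart a c s) {p. 0 < p $ 1 \<and> p $ 1 < b \<and> 0 < p $ 2 \<and> p $ 2 < d}"
proof (rule inj_onI; safe)
  fix p p' :: "real^2"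
  assume p: "0 < p $ 1" "0 < p $ 2" "p $ 2 < d" and p': "0 < p' $ 1" "0 < p' $ 2" "p' $ 2 < d"
    and eq: "elliptic_chart a c s p = elliptic_chart a c s p'"
  obtain n :: int where 1: "p $ 1 = p' $ 1" and n: "s * (p $ 2 - p' $ 2) = of_int n * (2 * pi)"
    using elliptic_point_eqD[OF \<open>a > 0\<close> _ _ eq[unfolded elliptic_chart_def]] p(1) p'(1)
    by (auto simp: algebra_simps)
  have "\<bar>of_int n\<bar> * (2 * pi) = \<bar>s\<bar> * \<bar>p $ 2 - p' $ 2\<bar>"
    using arg_cong[OF n, of abs] by (simp add: abs_mult)
  also have "\<dots> < \<bar>s\<bar> * d" using p p' \<open>s \<noteq> 0\<close> by (intro mult_strict_left_mono) auto
  finally have "\<bar>of_int n\<bar> * (2 * pi) < 1 * (2 * pi)" using assms(3) by linarith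
  then have "\<bar>real_of_int n\<bar> < 1" by (rule mult_right_less_imp_less) auto
  then have "n = 0" by linarith
  then have "p $ 2 = p' $ 2" using n \<open>s \<noteq> 0\<close> by simp
  with 1 show "p = p'" by (simp add: vec_eq_iff forall_2)
qed

lemma elliptic_chart_change_of_variables:
  fixes a b c d s :: real and f :: "real^2 \<Rightarrow> real"
  assumes "a > 0" "s \<noteq> 0" "\<bar>s\<bar> * d \<le> 2 * pi"
  defines "D \<equiv> {p :: real^2. 0 < p $ 1 \<and> p $ 1 < b \<and> 0 < p $ 2 \<and> p $ 2 < d}"
  defines "J \<equiv> \<lambda>p. \<bar>s\<bar> * (a\<^sup>2 * ((sinh (p $ 1))\<^sup>2 + (sin (c + s * p $ 2))\<^sup>2)) * f (elliptic_chart a c s p)"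
  assumes "J absolutely_integrable_on D"
  shows "f absolutely_integrable_on (elliptic_chart a c s ` D)"
    and "integral (elliptic_chart a c s ` D) f = integral D J"
proof -
  have "D = box (vector [0, 0]) (vector [b, d])"
    by (auto simp: D_def mem_box_cart forall_2)
  then have D: "D \<in> sets lebesgue" by simp
  \<comment> \<open>The change of variables theorem speaks of functions into a space
    \<open>real^'n\<close>, so f is read as a map into \<open>real^1\<close>.\<close>
  have "(\<lambda>p. \<bar>det (matrix (elliptic_chart_deriv a c s p))\<bar> *\<^sub>R (vec (f (elliptic_chart a c s p)) :: real^1)) absolutely_integrable_on D
      \<and> integral D (\<lambda>p. \<bar>det (matrix (elliptic_chart_deriv a c s p))\<bar> *\<^sub>R (vec (f (elliptic_chart a c s p)) :: real^1)) = vec (integral D J)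
    \<longleftrightarrow> (\<lambda>x. vec (f x) :: real^1) absolutely_integrable_on (elliptic_chart a c s ` D)
      \<and> integral (elliptic_chart a c s ` D) (\<lambda>x. vec (f x) :: real^1) = vec (integral D J)"
    using inj_on_elliptic_chart[OF assms(1-3), of c b] unfolding D_def[symmetric]
    by (intro has_absolute_integral_change_of_variables[OF D has_derivative_elliptic_chart])
  moreover have "J = (\<lambda>p. \<bar>det (matrix (elliptic_chart_deriv a c s p))\<bar> * f (elliptic_chart a c s p))"
    by (simp add: J_def abs_det_elliptic_chart_deriv)
  ultimately show "f absolutely_integrable_on (elliptic_chart a c s ` D)"
    and "integral (elliptic_chart a c s ` D) f = integral D J"
    using \<open>J absolutely_integrable_on D\<close>
    by (simp_all add: absolutely_integrable_on_1_iff integral_on_1_eq vec_eq_iff)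
qed

lemma elliptic_chart_integral_elliptic_product:
  fixes a b c d s :: real
  assumes chart: "a > 0" "s \<noteq> 0" "\<bar>s\<bar> * d \<le> 2 * pi"
    and N: "\<And>x. N (- x) = N x" "\<And>x. N (x + 2 * pi) = N x"
    and M: "continuous_on UNIV M" and contN: "continuous_on UNIV N"
  defines "D \<equiv> {p :: real^2. 0 < p $ 1 \<and> p $ 1 < b \<and> 0 < p $ 2 \<and> p $ 2 < d}"
  defines "J \<equiv> \<lambda>p. \<bar>s\<bar> * (a\<^sup>2 * ((sinh (p $ 1))\<^sup>2 + (sin (c + s * p $ 2))\<^sup>2)) * (M (p $ 1) * N (c + s * p $ 2))\<^sup>2"
  shows "J absolutely_integrable_on D"
    and "(\<lambda>x. (elliptic_product a M N x)\<^sup>2) absolutely_integrable_on (elliptic_chart a c s ` D)"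
    and "integral (elliptic_chart a c s ` D) (\<lambda>x. (elliptic_product a M N x)\<^sup>2) = integral D J"
proof -
  have box: "D = box (vector [0, 0]) (vector [b, d])"
    by (auto simp: D_def mem_box_cart forall_2)
  have "continuous_on UNIV J"
    unfolding J_def by (intro continuous_intros continuous_on_compose2[OF M] continuous_on_compose2[OF contN]) auto
  then have "J absolutely_integrable_on cbox (vector [0, 0]) (vector [b, d])"
    by (intro absolutely_integrable_continuous) (rule continuous_on_subset, auto)
  then show J: "J absolutely_integrable_on D"
    unfolding box by (rule set_integrable_subset) (auto simp: box_subset_cbox)
  let ?u = "\<lambda>x. (elliptic_product a M N x)\<^sup>2"
  let ?J = "\<lambda>p. \<bar>s\<bar> * (a\<^sup>2 * ((sinh (p $ 1))\<^sup>2 + (sin (c + s * p $ 2))\<^sup>2)) * ?u (elliptic_chart a c s p)"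
  have eq: "?J p = J p" if "p \<in> D" for p
    using that elliptic_product_elliptic_point[OF \<open>a > 0\<close> _ N, of "p $ 1" M]
    by (simp add: J_def D_def elliptic_chart_def)
  have "?J absolutely_integrable_on D"
    using J by (rule iffD2[OF set_integrable_cong, rotated -1]) (auto simp: eq)
  from elliptic_chart_change_of_variables[OF chart this[unfolded D_def]]
  show "?u absolutely_integrable_on (elliptic_chart a c s ` D)"
    and "integral (elliptic_chart a c s ` D) ?u = integral D J"
    using integral_cong[of D ?J J] eq by (simp_all add: D_def)
qed

text \<open>The affine map \<open>x \<mapsto> t + r x\<close> of the angle carries a pointwise bound on \<open>N\<close> over to the integrals
  over two pieces of the ellipse; this avoids iterated integrals.\<close>

lemma elliptic_chart_integral_compare:
  fixes a b c d s r t C :: real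
  assumes "a > 0" "s \<noteq> 0" "r > 0" "\<bar>s\<bar> * d \<le> 2 * pi" "\<bar>s * r\<bar> * d \<le> 2 * pi" "C \<ge> 0"
    and N: "\<And>x. N (- x) = N x" "\<And>x. N (x + 2 * pi) = N x"
    and M: "continuous_on UNIV M" and contN: "continuous_on UNIV N"
    and N_le: "\<And>x. 0 < x \<Longrightarrow> x < d \<Longrightarrow> (N (c + s * x))\<^sup>2 \<le> C * (N (c + s * (t + r * x)))\<^sup>2"
    and sin_le: "\<And>x. 0 < x \<Longrightarrow> x < d \<Longrightarrow> (sin (c + s * x))\<^sup>2 \<le> (sin (c + s * (t + r * x)))\<^sup>2"
  defines "D \<equiv> {p :: real^2. 0 < p $ 1 \<and> p $ 1 < b \<and> 0 < p $ 2 \<and> p $ 2 < d}"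
  shows "integral (elliptic_chart a c s ` D) (\<lambda>x. (elliptic_product a M N x)\<^sup>2)
      \<le> C / r * integral (elliptic_chart a (c + s * t) (s * r) ` D) (\<lambda>x. (elliptic_product a M N x)\<^sup>2)"
proof -
  define J where "J c s p = \<bar>s\<bar> * (a\<^sup>2 * ((sinh (p $ 1))\<^sup>2 + (sin (c + s * p $ 2))\<^sup>2)) * (M (p $ 1) * N (c + s * p $ 2))\<^sup>2"
    for c s and p :: "real^2"
  have "s * r \<noteq> 0" using assms by simp
  note 1 = elliptic_chart_integral_elliptic_product[where b = b and c = c, OF assms(1,2,4) N M contN, folded J_def D_def]
  note 2 = elliptic_chart_integral_elliptic_product[where b = b and c = "c + s * t", OF assms(1) \<open>s * r \<noteq> 0\<close> assms(5) N M contN, folded J_def D_def]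
  have "integral D (J c s) \<le> integral D (\<lambda>p. C / r * J (c + s * t) (s * r) p)"
  proof (rule integral_le)
    show "J c s integrable_on D" using 1(1) by (rule set_lebesgue_integral_eq_integral)
    show "(\<lambda>p. C / r * J (c + s * t) (s * r) p) integrable_on D"
      using 2(1) by (intro integrable_on_mult_right set_lebesgue_integral_eq_integral)
    fix p assume "p \<in> D"
    then have p: "0 < p $ 2" "p $ 2 < d" by (auto simp: D_def)
    have arg: "c + s * t + s * r * p $ 2 = c + s * (t + r * p $ 2)" by (simp add: algebra_simps)
    have "J c s p \<le> \<bar>s\<bar> * (a\<^sup>2 * ((sinh (p $ 1))\<^sup>2 + (sin (c + s * (t + r * p $ 2)))\<^sup>2)) *
        ((M (p $ 1))\<^sup>2 * (C * (N (c + s * (t + r * p $ 2)))\<^sup>2))"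
      unfolding J_def power_mult_distrib
      by (intro mult_mono mult_left_mono add_left_mono sin_le N_le p) auto
    \<comment> \<open>The Jacobian of the rescaled chart contains |s r| instead of |s|; this is the
      origin of 1/r.\<close>
    also have "\<dots> = C / r * J (c + s * t) (s * r) p"
      using \<open>r > 0\<close> unfolding J_def arg by (simp add: abs_mult power_mult_distrib)
    finally show "J c s p \<le> C / r * J (c + s * t) (s * r) p" .
  qed
  then show ?thesis using 1(3) 2(3) by simp
qed

section \<open>Geometry of the ellipse and the sector\<close>

lemma tanh_artanh_real:
  fixes x :: real
  assumes "\<bar>x\<bar> < 1"
  shows "tanh (artanh x) = x"
proof -
  have pos: "(1 + x) / (1 - x) > 0" "1 + x > 0" using assms by auto
  have "exp (- 2 * artanh x) = inverse ((1 + x) / (1 - x))"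
    using pos by (simp add: artanh_def exp_minus)
  then have "1 - exp (- 2 * artanh x) = 2 * x / (1 + x)" "1 + exp (- 2 * artanh x) = 2 / (1 + x)"
    using pos by (simp_all add: field_simps)
  then show ?thesis unfolding tanh_real_altdef using pos by simp
qed

lemma focal_distance_mu_boundary:
  assumes "a2 < a1" "0 < a2"
  shows "focal_distance a1 a2 > 0" "mu_boundary a1 a2 > 0"
    and "focal_distance a1 a2 * cosh (mu_boundary a1 a2) = a1"
    and "focal_distance a1 a2 * sinh (mu_boundary a1 a2) = a2"
proof -
  have "a2\<^sup>2 < a1\<^sup>2" using assms by (intro power_strict_mono) auto
  then show pos: "focal_distance a1 a2 > 0" by (simp add: focal_distance_def)
  have sq: "(focal_distance a1 a2)\<^sup>2 = a1\<^sup>2 - a2\<^sup>2"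
    using \<open>a2\<^sup>2 < a1\<^sup>2\<close> by (simp add: focal_distance_def)
  let ?m = "mu_boundary a1 a2"
  have tanh: "tanh ?m = a2 / a1"
    unfolding mu_boundary_def using assms by (intro tanh_artanh_real) (simp add: abs_less_iff)
  then have "tanh ?m > 0" using assms by simp
  then show "?m > 0" by simp
  have sinh: "a1 * sinh ?m = a2 * cosh ?m"
    using tanh assms by (simp add: tanh_def field_simps)
  have "(a1 * cosh ?m)\<^sup>2 - (a1 * sinh ?m)\<^sup>2 = a1\<^sup>2"
    by (simp add: power_mult_distrib cosh_square_eq algebra_simps)
  then have "(focal_distance a1 a2 * cosh ?m)\<^sup>2 = a1\<^sup>2"
    unfolding sinh by (simp add: power_mult_distrib sq algebra_simps)
  then show cosh: "focal_distance a1 a2 * cosh ?m = a1"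
    by (rule power2_eq_imp_eq) (use pos assms in auto)
  have "a1 * (focal_distance a1 a2 * sinh ?m) = a1 * a2"
    using sinh cosh by (metis mult.commute mult.left_commute)
  then show "focal_distance a1 a2 * sinh ?m = a2" using assms by simp
qed

text \<open>Through this inclusion the integral over a comparison strip becomes a lower bound for
  the denominator of the ratio.\<close>

lemma elliptic_point_in_ellipse:
  assumes a: "a2 < a1" "0 < a2" and \<mu>: "0 \<le> \<mu>" "\<mu> \<le> mu_boundary a1 a2"
  shows "elliptic_point (focal_distance a1 a2) \<mu> \<nu> \<in> ellipse a1 a2"
proof -
  let ?f = "focal_distance a1 a2" and ?m = "mu_boundary a1 a2"
  note f = focal_distance_mu_boundary[OF a]
  have "?f * cosh \<mu> \<le> ?f * cosh ?m" "?f * sinh \<mu> \<le> ?f * sinh ?m"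
    using \<mu> f(1,2) by (auto simp: cosh_real_nonneg_le_iff)
  then have "?f * cosh \<mu> \<le> a1" "?f * sinh \<mu> \<le> a2" by (simp_all only: f(3,4))
  then have "(?f * cosh \<mu> / a1)\<^sup>2 \<le> 1" "(?f * sinh \<mu> / a2)\<^sup>2 \<le> 1"
    using a \<mu> f(1) by (auto intro!: power_le_one)
  then have "(?f * cosh \<mu> / a1)\<^sup>2 * (cos \<nu>)\<^sup>2 + (?f * sinh \<mu> / a2)\<^sup>2 * (sin \<nu>)\<^sup>2 \<le> 1 * (cos \<nu>)\<^sup>2 + 1 * (sin \<nu>)\<^sup>2"
    by (intro add_mono mult_right_mono) auto
  then show ?thesis
    by (simp add: ellipse_def elliptic_point_def power_mult_distrib power_divide)
qed

lemma ellipse_sector_subset_charts: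
  fixes a1 a2 \<nu>0 :: real
  defines "F \<equiv> elliptic_chart (focal_distance a1 a2)"
    and "D \<equiv> {p :: real^2. 0 < p $ 1 \<and> p $ 1 < mu_boundary a1 a2 \<and> 0 < p $ 2 \<and> p $ 2 < \<nu>0}"
  obtains Z where "negligible Z"
    "ellipse_sector a1 a2 \<nu>0 \<subseteq> Z \<union> (\<Union>(c, s)\<in>{0, pi} \<times> {1, - 1}. F c s ` D)"
proof
  \<comment> \<open>The open boxes, chosen to make the charts injective, miss the focal segment and
    the curves with angle 0 or pi; these are images of hyperplanes under differentiable maps, hence
    null sets.\<close>
  define Z where "Z = F 0 1 ` {p. p $ 1 = 0} \<union> F 0 1 ` {p. p $ 2 = 0} \<union> F pi 1 ` {p. p $ 2 = 0}"
  have "negligible (F c s ` {p. p $ k = 0})" for c s k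
  proof (rule negligible_differentiable_image_negligible)
    show "negligible {p :: real^2. p $ k = 0}" by (rule negligible_standard_hyperplane_cart)
    show "F c s differentiable_on {p. p $ k = 0}"
      unfolding F_def differentiable_on_def differentiable_def using has_derivative_elliptic_chart by blast
  qed auto
  then show "negligible Z" unfolding Z_def by (intro negligible_Un)
  show "ellipse_sector a1 a2 \<nu>0 \<subseteq> Z \<union> (\<Union>(c, s)\<in>{0, pi} \<times> {1, - 1}. F c s ` D)"
  proof
    fix x assume "x \<in> ellipse_sector a1 a2 \<nu>0"
    then obtain \<mu> \<nu> where x: "x = elliptic_point (focal_distance a1 a2) \<mu> \<nu>"
      and \<mu>: "0 \<le> \<mu>" "\<mu> < mu_boundary a1 a2" and \<nu>: "\<bar>\<nu>\<bar> < \<nu>0 \<or> \<bar>pi - \<nu>\<bar> < \<nu>0"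
      unfolding ellipse_sector_def by blast
    have F: "x = F c s (vector [\<mu>, y])" if "c + s * y = \<nu>" for c s y
      unfolding F_def elliptic_chart_def vector_2 that by (rule x)
    have Z: "x \<in> Z" if "\<mu> = 0 \<or> \<nu> = 0 \<or> \<nu> = pi"
      using that F[of 0 1 \<nu>] F[of 0 1 0] F[of pi 1 0] unfolding Z_def by auto
    have D: "x \<in> F c s ` D" if "c + s * y = \<nu>" "0 < y" "y < \<nu>0" "\<mu> \<noteq> 0" for c s y
      unfolding F[OF that(1)] using that \<mu> by (intro imageI) (auto simp: D_def)
    consider "\<mu> = 0 \<or> \<nu> = 0 \<or> \<nu> = pi" | "\<mu> \<noteq> 0" "0 < \<nu>" "\<nu> < \<nu>0" | "\<mu> \<noteq> 0" "0 < - \<nu>" "- \<nu> < \<nu>0"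
      | "\<mu> \<noteq> 0" "0 < \<nu> - pi" "\<nu> - pi < \<nu>0" | "\<mu> \<noteq> 0" "0 < pi - \<nu>" "pi - \<nu> < \<nu>0"
      using \<nu> by linarith
    then show "x \<in> Z \<union> (\<Union>(c, s)\<in>{0, pi} \<times> {1, - 1}. F c s ` D)"
      by cases (use Z D[of 0 1 \<nu>] D[of 0 "- 1" "- \<nu>"] D[of pi 1 "\<nu> - pi"] D[of pi "- 1" "pi - \<nu>"] in auto)
  qed
qed

text \<open>The 4 counts the pieces of the sector, each bounded by C/r times the integral over the
  whole ellipse. The conditions on t and r keep x <= t + r x <= pi/2, where the sine, and with it
  the area element, increases.\<close>

proposition L2_ratio_elliptic_product_le:
  fixes a1 a2 \<nu>0 t r C :: real
  assumes a: "a2 < a1" "0 < a2" and \<nu>0: "0 < \<nu>0" "\<nu>0 < pi / 2"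
    and t: "\<nu>0 \<le> t" "t + r * \<nu>0 \<le> pi / 2" and "r > 0" "C \<ge> 0"
    and N: "\<And>x. N (- x) = N x" "\<And>x. N (x + 2 * pi) = N x"
    and M: "continuous_on UNIV M" and contN: "continuous_on UNIV N"
    and N_le: "\<And>c s x. c \<in> {0, pi} \<Longrightarrow> s \<in> {1, - 1} \<Longrightarrow> 0 < x \<Longrightarrow> x < \<nu>0 \<Longrightarrow>
      (N (c + s * x))\<^sup>2 \<le> C * (N (c + s * (t + r * x)))\<^sup>2"
  shows "L2_ratio a1 a2 \<nu>0 (elliptic_product (focal_distance a1 a2) M N) \<le> sqrt (4 * (C / r))"
proof -
  let ?f = "focal_distance a1 a2"
  define u where "u x = (elliptic_product ?f M N x)\<^sup>2" for x
  define D where "D = {p :: real^2. 0 < p $ 1 \<and> p $ 1 < mu_boundary a1 a2 \<and> 0 < p $ 2 \<and> p $ 2 < \<nu>0}"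
  define P where "P = (\<lambda>(c, s). elliptic_chart ?f c s ` D)"
  let ?I = "{0, pi} \<times> {1, - 1 :: real}"
  define num where "num = (LINT x:ellipse_sector a1 a2 \<nu>0|lebesgue. u x)"
  define den where "den = (LINT x:ellipse a1 a2|lebesgue. u x)"
  note f = focal_distance_mu_boundary[OF a]
  have u: "u x \<ge> 0" for x by (simp add: u_def)
  have K: "C / r \<ge> 0" using assms by simp
  have den: "den \<ge> 0" unfolding den_def set_lebesgue_integral_def by (intro Bochner_Integration.integral_nonneg) (simp add: u)
  have "num \<le> 4 * (C / r) * den"
    if intE: "u absolutely_integrable_on ellipse a1 a2" and intS: "u absolutely_integrable_on ellipse_sector a1 a2 \<nu>0"
  proof -
    have r\<nu>0: "\<bar>s\<bar> * \<nu>0 \<le> 2 * pi" "\<bar>s * r\<bar> * \<nu>0 \<le> 2 * pi" if "s \<in> {1, - 1}" for s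
      using that t \<nu>0 \<open>r > 0\<close> by (auto simp: abs_mult)
    have piece: "u absolutely_integrable_on P i" "integral (P i) u \<le> C / r * den" if "i \<in> ?I" for i
    proof -
      obtain c s where i: "i = (c, s)" by (cases i)
      have cs: "c \<in> {0, pi}" "s \<in> {1, - 1}" "s \<noteq> 0" using that i by auto
      show "u absolutely_integrable_on P i"
        unfolding P_def i prod.case u_def D_def using cs(3) r\<nu>0(1)[OF cs(2)] f(1)
        by (intro elliptic_chart_integral_elliptic_product(2) N M contN)
      have "integral (P i) u \<le> C / r * integral (elliptic_chart ?f (c + s * t) (s * r) ` D) u"
        unfolding P_def i prod.case u_def D_def
      proof (rule elliptic_chart_integral_compare[OF f(1) cs(3) \<open>r > 0\<close> r\<nu>0[OF cs(2)] \<open>C \<ge> 0\<close> N M contN])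
        fix x assume x: "0 < x" "x < \<nu>0"
        show "(N (c + s * x))\<^sup>2 \<le> C * (N (c + s * (t + r * x)))\<^sup>2" by (rule N_le[OF cs(1,2) x])
        have "t + r * x \<le> pi / 2" using x t(2) \<open>r > 0\<close> mult_left_mono[of x \<nu>0 r] by linarith
        moreover have "x \<le> t + r * x" using x t(1) \<open>r > 0\<close> by (simp add: add_increasing2)
        ultimately have "sin x \<le> sin (t + r * x)" "0 \<le> sin x"
          using x \<nu>0 by (auto intro!: sin_mono_le_eq[THEN iffD2] sin_ge_zero)
        then have "(sin x)\<^sup>2 \<le> (sin (t + r * x))\<^sup>2" by (intro power_mono)
        moreover have "(sin (c + s * y))\<^sup>2 = (sin y)\<^sup>2" for y using cs by auto
        ultimately show "(sin (c + s * x))\<^sup>2 \<le> (sin (c + s * (t + r * x)))\<^sup>2" by simp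
      qed
      also have "\<dots> \<le> C / r * den"
      proof (rule mult_left_mono[OF _ K])
        have "elliptic_chart ?f (c + s * t) (s * r) ` D \<subseteq> ellipse a1 a2"
          unfolding elliptic_chart_def D_def by (auto intro!: elliptic_point_in_ellipse[OF a])
        moreover have "u absolutely_integrable_on (elliptic_chart ?f (c + s * t) (s * r) ` D)"
          unfolding u_def D_def using cs(3) \<open>r > 0\<close> r\<nu>0(2)[OF cs(2)] f(1)
          by (intro elliptic_chart_integral_elliptic_product(2) N M contN) auto
        ultimately have "integral (elliptic_chart ?f (c + s * t) (s * r) ` D) u \<le> integral (ellipse a1 a2) u"
          using intE u by (intro integral_subset_le set_lebesgue_integral_eq_integral(1)) auto
        then show "integral (elliptic_chart ?f (c + s * t) (s * r) ` D) u \<le> den"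
          unfolding den_def set_lebesgue_integral_eq_integral(2)[OF intE] .
      qed
      finally show "integral (P i) u \<le> C / r * den" .
    qed
    obtain Z where Z: "negligible Z" "ellipse_sector a1 a2 \<nu>0 \<subseteq> Z \<union> (\<Union>(c, s)\<in>?I. elliptic_chart ?f c s ` D)"
      unfolding D_def by (rule ellipse_sector_subset_charts)
    have "num \<le> (LINT x|lebesgue. (\<Sum>i\<in>?I. indicator (P i) x *\<^sub>R u x))"
      unfolding num_def set_lebesgue_integral_def
    proof (rule integral_mono_AE)
      show "integrable lebesgue (\<lambda>x. indicator (ellipse_sector a1 a2 \<nu>0) x *\<^sub>R u x)"
        using intS by (simp add: set_integrable_def)
      show "integrable lebesgue (\<lambda>x. \<Sum>i\<in>?I. indicator (P i) x *\<^sub>R u x)"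
        using piece(1) by (intro Bochner_Integration.integrable_sum) (simp add: set_integrable_def)
      have "AE x in lebesgue. x \<notin> Z" using Z(1) by (intro AE_not_in) (simp add: negligible_iff_null_sets)
      then show "AE x in lebesgue. indicator (ellipse_sector a1 a2 \<nu>0) x *\<^sub>R u x \<le> (\<Sum>i\<in>?I. indicator (P i) x *\<^sub>R u x)"
      proof (rule AE_mp, intro AE_I2 impI)
        fix x assume "x \<notin> Z"
        show "indicator (ellipse_sector a1 a2 \<nu>0) x *\<^sub>R u x \<le> (\<Sum>i\<in>?I. indicator (P i) x *\<^sub>R u x)"
        proof (cases "x \<in> ellipse_sector a1 a2 \<nu>0")
          case True
          have "ellipse_sector a1 a2 \<nu>0 \<subseteq> Z \<union> (\<Union>i\<in>?I. P i)" using Z(2) unfolding P_def .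
          with True obtain i where i: "i \<in> ?I" "x \<in> P i" using \<open>x \<notin> Z\<close> by blast
          have "u x = indicator (P i) x *\<^sub>R u x" using i by simp
          also have "\<dots> \<le> (\<Sum>i\<in>?I. indicator (P i) x *\<^sub>R u x)"
            using u[of x] by (intro member_le_sum[OF i(1)]) auto
          finally show ?thesis using True by simp
        qed (simp add: sum_nonneg u)
      qed
    qed
    also have "\<dots> = (\<Sum>i\<in>?I. LINT x:P i|lebesgue. u x)"
      unfolding set_lebesgue_integral_def
      using piece(1) by (intro Bochner_Integration.integral_sum) (simp add: set_integrable_def)
    also have "\<dots> \<le> (\<Sum>i\<in>?I. C / r * den)"
      using piece by (intro sum_mono) (simp add: set_lebesgue_integral_eq_integral(2))
    also have "\<dots> = 4 * (C / r) * den" by (simp add: card_cartesian_product)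
    finally show ?thesis .
  qed
  moreover have "num / den \<le> 4 * (C / r)" if "num \<le> 4 * (C / r) * den"
  proof (cases "den = 0")
    case True
    then show ?thesis using mult_left_mono[OF K, of 4] by simp
  next
    case False
    then have "den > 0" using den by simp
    then show ?thesis using that by (simp only: pos_divide_le_eq)
  qed
  \<comment> \<open>A Bochner integral of a non-integrable function is \<open>0\<close>, and so is a quotient by \<open>0\<close>.\<close>
  moreover have "num / den \<le> 4 * (C / r)" if "\<not> u absolutely_integrable_on ellipse a1 a2 \<or> \<not> u absolutely_integrable_on ellipse_sector a1 a2 \<nu>0"
    using that K unfolding num_def den_def set_lebesgue_integral_def set_integrable_def
    by (auto simp: not_integrable_integral_eq)
  ultimately have "num / den \<le> 4 * (C / r)" by blast
  then show ?thesis
    unfolding L2_ratio_def num_def den_def u_def by (rule real_sqrt_le_mono)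
qed

subsection \<open>Localization\<close>

text \<open>The available exponent is Q s \<phi> (1 + c) up to a bounded term, the required one is Q
  \<phi> sin \<phi> = 2 Q s \<phi> c. The difference Q s \<phi> (1 - c) eventually exceeds the
  constant B. Of the factor sqrt 2 pi e only that it is at least 1 is used.\<close>

lemma localization_constant_asymptotics:
  fixes \<phi> r :: real
  assumes "0 < \<phi>" "\<phi> < pi / 2" "r > 0"
  defines "s \<equiv> sin (\<phi> / 2)" and "c \<equiv> cos (\<phi> / 2)"
  shows "\<forall>\<^sub>F Q in at_top. sqrt (4 * (4 * exp (- 2 * (2 * Q * s - 4 / s) * (\<phi> / 4 * (1 + c))) / r))
      \<le> sqrt 2 * pi * exp 1 * exp (- (1 / 2) * Q * \<phi> * sin \<phi>)"
proof -
  have s: "s > 0" unfolding s_def using assms by (intro sin_gt_zero) auto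
  have "c < 1" unfolding c_def using assms cos_monotone_0_pi[of 0 "\<phi> / 2"] by simp
  then have A: "s * \<phi> * (1 - c) > 0" using s assms by simp
  have sin: "sin \<phi> = 2 * s * c" unfolding s_def c_def using sin_double[of "\<phi> / 2"] by simp
  define B where "B = ln (16 / r) + 2 * \<phi> * (1 + c) / s"
  have "\<forall>\<^sub>F Q in at_top. Q \<ge> B / (s * \<phi> * (1 - c))" by (rule eventually_ge_at_top)
  then show ?thesis
  proof eventually_elim
    case (elim Q)
    then have "B \<le> Q * (s * \<phi> * (1 - c))" using A by (simp add: field_simps)
    moreover have "ln (16 / r) + - 2 * (2 * Q * s - 4 / s) * (\<phi> / 4 * (1 + c)) =
        B - Q * (s * \<phi> * (1 - c)) + - Q * \<phi> * sin \<phi>"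
      unfolding B_def sin using s by (simp add: field_simps)
    ultimately have le: "ln (16 / r) + - 2 * (2 * Q * s - 4 / s) * (\<phi> / 4 * (1 + c)) \<le> - Q * \<phi> * sin \<phi>"
      by linarith
    have "4 * (4 * exp (- 2 * (2 * Q * s - 4 / s) * (\<phi> / 4 * (1 + c))) / r) =
        exp (ln (16 / r) + - 2 * (2 * Q * s - 4 / s) * (\<phi> / 4 * (1 + c)))"
      unfolding exp_add using \<open>r > 0\<close> by simp
    also have "\<dots> \<le> exp (- Q * \<phi> * sin \<phi>)" using le by simp
    also have "\<dots> = (1 * exp (- (1 / 2) * Q * \<phi> * sin \<phi>))\<^sup>2"
      by (simp flip: exp_double)
    also have "\<dots> \<le> (sqrt 2 * pi * exp 1 * exp (- (1 / 2) * Q * \<phi> * sin \<phi>))\<^sup>2"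
    proof (intro power_mono mult_right_mono)
      have "1 * 1 * 1 \<le> sqrt 2 * pi * exp (1 :: real)"
        using pi_ge_two by (intro mult_mono) auto
      then show "1 \<le> sqrt 2 * pi * exp (1 :: real)" by simp
    qed auto
    finally show ?case by (rule real_le_lsqrt[rotated]) simp
  qed
qed

theorem mainTheorem6:
  fixes a1 a2 \<nu>0 :: real
    and ce0 Mc0 :: "real \<Rightarrow> real \<Rightarrow> real"
    and q k :: "nat \<Rightarrow> real"
    and u :: "nat \<Rightarrow> real^2 \<Rightarrow> real"
  assumes "a1 > a2" and "a2 > 0"
    and ce0: "\<And>p. p > 0 \<Longrightarrow> is_ce0 p (ce0 p)"
    and Mc0: "\<And>p. p > 0 \<Longrightarrow> is_Mc0 p (Mc0 p)"
    and q: "\<And>m. q m > 0 \<and> Mc0 (q m) (mu_boundary a1 a2) = 0 \<and>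
              finite {\<mu>. 0 < \<mu> \<and> \<mu> < mu_boundary a1 a2 \<and> Mc0 (q m) \<mu> = 0} \<and>
              card {\<mu>. 0 < \<mu> \<and> \<mu> < mu_boundary a1 a2 \<and> Mc0 (q m) \<mu> = 0} = m"
    and k: "\<And>m. k m = sqrt (4 * q m) / focal_distance a1 a2"
    and u: "\<And>m. u m = elliptic_product (focal_distance a1 a2) (Mc0 (q m)) (ce0 (q m))"
    and "0 < \<nu>0" and "\<nu>0 < pi / 2"
  shows "\<forall>\<^sub>F m in sequentially.
           L2_ratio a1 a2 \<nu>0 (u m)
             \<le> sqrt 2 * pi * exp 1 *
                exp (- (1 / 4) * eccentricity a1 a2 * k m * a1 * (pi / 2 - \<nu>0) * sin (pi / 2 - \<nu>0))"
proof -
  let ?f = "focal_distance a1 a2" and ?b = "mu_boundary a1 a2"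
  note f = focal_distance_mu_boundary[OF \<open>a2 < a1\<close> \<open>0 < a2\<close>]
  have "\<exists>\<alpha>. is_mathieu_a0 (q m) \<alpha> \<and> even_periodic_mathieu_solution \<alpha> (q m) (ce0 (q m)) \<and>
      modified_mathieu_solution \<alpha> (q m) (Mc0 (q m))" for m
  proof -
    obtain \<alpha> \<beta> where \<alpha>: "is_mathieu_a0 (q m) \<alpha>" "even_periodic_mathieu_solution \<alpha> (q m) (ce0 (q m))"
      and \<beta>: "is_mathieu_a0 (q m) \<beta>" "modified_mathieu_solution \<beta> (q m) (Mc0 (q m))"
      using ce0[of "q m"] Mc0[of "q m"] q[of m] unfolding is_ce0_def is_Mc0_def by blast
    \<comment> \<open>The angular and the radial function each bring their own smallest eigenvalue;
      minimality identifies them.\<close>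
    have "\<alpha> = \<beta>"
      using \<alpha>(1) \<beta>(1) unfolding is_mathieu_a0_def by (meson order_antisym)
    then show ?thesis using \<alpha> \<beta> by blast
  qed
  then obtain \<alpha> where a0: "\<And>m. is_mathieu_a0 (q m) (\<alpha> m)"
    and N: "\<And>m. even_periodic_mathieu_solution (\<alpha> m) (q m) (ce0 (q m))"
    and M: "\<And>m. modified_mathieu_solution (\<alpha> m) (q m) (Mc0 (q m))" by metis
  have q_at_top: "filterlim q at_top sequentially"
    unfolding filterlim_at_top
  proof
    fix B :: real
    \<comment> \<open>The bound on the number of zeros for q up to B; it fails as soon as m exceeds
      it.\<close>
    define K where "K = (2 * B * cosh (2 * ?b) + 2 * B + 1) * ?b + 1"
    have "\<forall>\<^sub>F m in sequentially. K < real m"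
      using filterlim_real_sequentially by (simp add: filterlim_at_top_dense)
    then show "\<forall>\<^sub>F m in sequentially. B \<le> q m"
    proof eventually_elim
      case (elim m)
      show ?case
      proof (rule ccontr)
        assume "\<not> B \<le> q m"
        then have "real m \<le> K"
          using modified_mathieu_zeros_bound[OF M[of m] mathieu_eigenvalue_lower_bound[OF N[of m]], of B ?b] q[of m] f(2)
          by (simp add: K_def)
        then show False using elim by simp
      qed
    qed
  qed
  define \<phi> where "\<phi> = pi / 2 - \<nu>0"
  have \<phi>: "0 < \<phi>" "\<phi> < pi / 2" using \<open>0 < \<nu>0\<close> \<open>\<nu>0 < pi / 2\<close> by (auto simp: \<phi>_def)
  define s c where "s = sin (\<phi> / 2)" and "c = cos (\<phi> / 2)"
  have s: "s > 0" unfolding s_def using \<phi> by (intro sin_gt_zero) auto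
  have c: "0 < c" "c < 1"
    unfolding c_def using \<phi> cos_monotone_0_pi[of 0 "\<phi> / 2"] by (auto intro!: cos_gt_zero)
  \<comment> \<open>Exponential growth is used on \<open>[\<nu>0, \<nu>1]\<close>, and the mass on \<open>[0, \<nu>0]\<close> is compared with
    that on \<open>[\<nu>1 - \<eta>, \<nu>1]\<close>. At \<open>\<nu>1\<close> the growth rate is \<open>2 s \<surd>q\<close> up to a bounded error, and
    \<open>2 s > sin \<phi>\<close>; the loss \<open>\<eta>\<close> is chosen to preserve this gain.\<close>
  define \<nu>1 \<eta> where "\<nu>1 = pi / 2 - \<phi> / 2" and "\<eta> = \<phi> / 4 * (1 - c)"
  define t r where "t = \<nu>1 - \<eta>" and "r = \<eta> / \<nu>0"
  have \<eta>: "0 < \<eta>" using \<phi> c by (simp add: \<eta>_def)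
  have r: "r > 0" "r * \<nu>0 = \<eta>" using \<eta> \<open>0 < \<nu>0\<close> by (auto simp: r_def)
  have "\<nu>0 = pi / 2 - \<phi>" by (simp add: \<phi>_def)
  then have t: "t - \<nu>0 = \<phi> / 4 * (1 + c)" by (simp add: t_def \<nu>1_def \<eta>_def field_simps)
  moreover have "0 \<le> \<phi> / 4 * (1 + c)" using \<phi> c by simp
  ultimately have "\<nu>0 \<le> t" by linarith
  have \<nu>1: "\<nu>1 \<le> pi / 2" "t + r * \<nu>0 = \<nu>1" "cos \<nu>1 = s"
    using \<phi> r by (simp_all add: \<nu>1_def t_def s_def cos_diff)
  have "filterlim (\<lambda>m. sqrt (q m)) at_top sequentially"
    by (rule filterlim_compose[OF sqrt_at_top q_at_top])
  then have "\<forall>\<^sub>F m in sequentially. sqrt (4 * (4 * exp (- 2 * (2 * sqrt (q m) * s - 4 / s) * (\<phi> / 4 * (1 + c))) / r))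
      \<le> sqrt 2 * pi * exp 1 * exp (- (1 / 2) * sqrt (q m) * \<phi> * sin \<phi>)"
    unfolding s_def c_def by (rule eventually_compose_filterlim[OF localization_constant_asymptotics[OF \<phi> r(1)]])
  \<comment> \<open>The 1 gives q >= 1 for the eigenvalue bound; 2/s^2 gives \<kappa> >= 0 and the
    estimate of \<kappa>^2 below.\<close>
  moreover have "\<forall>\<^sub>F m in sequentially. max 1 (2 / s\<^sup>2) \<le> sqrt (q m)"
    using \<open>filterlim (\<lambda>m. sqrt (q m)) at_top sequentially\<close> by (simp only: filterlim_at_top)
  ultimately show ?thesis
  proof eventually_elim
    case (elim m)
    have qm: "q m > 0" "sqrt (q m) \<ge> 1" "2 / s\<^sup>2 \<le> sqrt (q m)" using elim q by auto
    \<comment> \<open>An explicit stand-in for the square root of 4 q s^2 - 8 sqrt q: its square has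
      -16 sqrt q + 16/s^2 after the leading term, and half of the 16 sqrt q absorbs 16/s^2.\<close>
    define \<kappa> where "\<kappa> = 2 * sqrt (q m) * s - 4 / s"
    have "2 * (2 / s\<^sup>2) * s \<le> 2 * sqrt (q m) * s" using qm s by (intro mult_right_mono) auto
    then have \<kappa>: "\<kappa> \<ge> 0" using s by (simp add: \<kappa>_def power2_eq_square)
    have "\<kappa>\<^sup>2 = 4 * q m * s\<^sup>2 - 16 * sqrt (q m) + 8 * (2 / s\<^sup>2)"
      using s qm by (simp add: \<kappa>_def power2_diff power_mult_distrib power_divide field_simps power2_eq_square[of s])
    then have \<kappa>_sq: "\<kappa>\<^sup>2 \<le> 4 * q m * (cos \<nu>1)\<^sup>2 - 8 * sqrt (q m)"
      unfolding \<nu>1 using qm(3) by linarith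
    have "q m \<ge> 1" using qm by simp
    then obtain \<beta> N\<^sub>\<beta> where "\<beta> \<le> - 2 * q m + 8 * sqrt (q m)" "even_periodic_mathieu_solution \<beta> (q m) N\<^sub>\<beta>"
      by (rule even_periodic_mathieu_solution_exists)
    then have \<alpha>: "\<alpha> m \<le> - 2 * q m + 8 * sqrt (q m)"
      using a0[of m] unfolding is_mathieu_a0_def by (meson order_trans)
    define C where "C = 4 * exp (- 2 * \<kappa> * (\<phi> / 4 * (1 + c)))"
    have "L2_ratio a1 a2 \<nu>0 (elliptic_product ?f (Mc0 (q m)) (ce0 (q m))) \<le> sqrt (4 * (C / r))"
    proof (rule L2_ratio_elliptic_product_le[where t = t and r = r])
      show "t + r * \<nu>0 \<le> pi / 2" using \<nu>1 by simp
      show "C \<ge> 0" by (simp add: C_def)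
      show "\<And>x. ce0 (q m) (- x) = ce0 (q m) x" "\<And>x. ce0 (q m) (x + 2 * pi) = ce0 (q m) x"
        using N[of m] unfolding even_periodic_mathieu_solution_def by blast+
      have "\<exists>N'. \<forall>x. (ce0 (q m) has_real_derivative N' x) (at x)"
        using N[of m] unfolding even_periodic_mathieu_solution_def mathieu_solution_def by blast
      then show "continuous_on UNIV (ce0 (q m))"
        by (intro continuous_at_imp_continuous_on) (blast intro: DERIV_isCont)
      have "\<exists>M'. \<forall>x. (Mc0 (q m) has_real_derivative M' x) (at x)"
        using M[of m] unfolding modified_mathieu_solution_def by blast
      then show "continuous_on UNIV (Mc0 (q m))"
        by (intro continuous_at_imp_continuous_on) (blast intro: DERIV_isCont)
      fix e \<sigma> x :: real
      assume e\<sigma>: "e \<in> {0, pi}" "\<sigma> \<in> {1, - 1}" and x: "0 < x" "x < \<nu>0"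
      have y: "t \<le> t + r * x" "t + r * x \<le> \<nu>1"
        using x r(1) mult_left_mono[of x \<nu>0 r] \<nu>1(2) by auto
      have "(ce0 (q m) (e + \<sigma> * x))\<^sup>2 \<le> 4 * exp (- 2 * \<kappa> * (t + r * x - x)) * (ce0 (q m) (e + \<sigma> * (t + r * x)))\<^sup>2"
        using x y \<open>\<nu>0 \<le> t\<close> qm
        by (intro even_periodic_mathieu_solution_growth[OF N \<alpha> \<kappa> \<kappa>_sq _ \<nu>1(1) e\<sigma>]) auto
      also have "\<dots> \<le> C * (ce0 (q m) (e + \<sigma> * (t + r * x)))\<^sup>2"
      proof (intro mult_right_mono)
        have "\<kappa> * (t - \<nu>0) \<le> \<kappa> * (t + r * x - x)" using \<kappa> x y by (intro mult_left_mono) auto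
        then show "4 * exp (- 2 * \<kappa> * (t + r * x - x)) \<le> C" unfolding C_def t[symmetric] by simp
      qed auto
      finally show "(ce0 (q m) (e + \<sigma> * x))\<^sup>2 \<le> C * (ce0 (q m) (e + \<sigma> * (t + r * x)))\<^sup>2" .
    qed fact+
    also have "\<dots> \<le> sqrt 2 * pi * exp 1 * exp (- (1 / 2) * sqrt (q m) * \<phi> * sin \<phi>)"
      using elim(1) by (simp only: C_def \<kappa>_def)
    \<comment> \<open>The eccentricity times a1 is the focal distance, and k m times the focal
      distance is 2 sqrt(q m).\<close>
    also have "- (1 / 2) * sqrt (q m) * \<phi> * sin \<phi> =
        - (1 / 4) * eccentricity a1 a2 * k m * a1 * (pi / 2 - \<nu>0) * sin (pi / 2 - \<nu>0)"
    proof -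
      have "1 - a2\<^sup>2 / a1\<^sup>2 = (a1\<^sup>2 - a2\<^sup>2) / a1\<^sup>2"
        using \<open>a2 < a1\<close> \<open>0 < a2\<close> by (simp add: diff_divide_distrib)
      then have "eccentricity a1 a2 * a1 = ?f"
        using \<open>a2 < a1\<close> \<open>0 < a2\<close> by (simp add: eccentricity_def focal_distance_def real_sqrt_divide)
      then have "eccentricity a1 a2 * k m * a1 = 2 * sqrt (q m)"
        using f(1) by (simp add: k real_sqrt_mult mult_ac) (simp add: field_simps)
      then show ?thesis by (simp add: \<phi>_def mult.assoc)
    qed
    finally show ?case unfolding u .
  qed
qed

end
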